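(* Let $P,Q,H$ be standard parabolic subgroups of $G$. Let $\phi\in\operatorname{Hom}_{\mathcal{Q}_W}(\mathcal{Q}_{W/W_Q}^*,\mathcal{Q}_{W/W_P}^* )$ and $\psi\in\operatorname{Hom}_{\mathcal{Q}_W}(\mathcal{Q}_{W/W_P}^*,\mathcal{Q}_{W/W_H}^* )$ have coordinates $(b_v)_{v\in W^P}$ and $(c_u)_{u\in W^H}$ in the standard localization basis, i.e. $\phi(f_e)=\sum_{v\in W^P}b_vf_v$ and $\psi(f_e)=\sum_{u\in W^H}c_uf_u$ with $b_v,c_u\in\mathcal{Q}$. Then the coordinates $(a_w)_{w\in W^H}=(c_u)\circ(b_v)$ of the product $\psi\circ\phi$ (which for $\phi\in\mathtt{h}_T(G/Q\times G/P)^W$ and $\psi\in\mathtt{h}_T(G/P\times G/H)^W$ is the correspondence product), defined by $(\psi\circ\phi)(f_e)=\sum_{w\in W^H}a_wf_w$, are $$a_w=\sum_{\{v\in W^P,\ u\in W^H\ \mid\ \overline{vu}=w\}}b_v\,v(c_u)\qquad\text{for all } w\in W^H.$$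
   Context: $k$ is a field of characteristic $0$; $G$ is a split semisimple linear algebraic group over $k$ with split maximal torus $T$, character group $T^*$, Borel subgroup $B\supseteq T$, root system $\Sigma$, Weyl group $W$. For a standard parabolic $P\supseteq B$, $W_P$ is the Weyl group of its Levi part and $W^P$ is the set of minimal length representatives of $W/W_P$; $\overline{w}\in W^P$ (resp. $W^H$) denotes the minimal representative of the coset of $w$. $\mathtt{h}(-)=\Omega(-)\otimes_{\mathbb{L}}R$ is an algebraic oriented cohomology theory (Levine–Morel) with formal group law $F$ over $R=\mathtt{h}(pt)$, $\mathtt{h}_T$ is its $T$-equivariant version (Borel construction), assumed Chern-complete, so that $S=\mathtt{h}_T(pt)=R[[x_\lambda]]_{\lambda\in T^*}/J$ (or $R[x_\lambda]_{\lambda\in T^*}/J$ if $F$ is a polynomial), $J$ the closure of the ideal of relations $x_0=0$, $x_{\lambda+\mu}=F(x_\lambda,x_\mu)$. $S$ is assumed $\Sigma$-regular: every $x_\alpha$, $\alpha\in\Sigma$, is a non-zero-divisor. $W$ acts on $S$ by $w(x_\lambda)=x_{w(\lambda)}$. $\mathcal{Q}=S[\tfrac1{x_\alpha},\alpha\in\Sigma]$. The twisted group algebra $\mathcal{Q}_W$ is the free left $\mathcal{Q}$-module with basis $\{\delta_w\}_{w\in W}$ and multiplication determined by $\delta_w\delta_{w'}=\delta_{ww'}$ and $w(q)\delta_w=\delta_wq$, $q\in\mathcal{Q}$. $\mathcal{Q}_{W/W_P}$ is the free $\mathcal{Q}$-module with basis $\delta_{\bar w}$, $\bar w\in W/W_P$;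 $\mathcal{Q}_{W/W_P}^*=\operatorname{Hom}_{\mathcal{Q}}(\mathcal{Q}_{W/W_P},\mathcal{Q})$ has dual basis $\{f_v\}_{v\in W^P}$ (indexed by minimal coset representatives). $\mathcal{Q}_W$ acts on $\mathcal{Q}_{W/W_P}^*$ by $(p\delta_w)\odot(qf_v)=p\,w(q)f_{\overline{wv}}$. A $\mathcal{Q}_W$-homomorphism from $\mathcal{Q}_{W/W_Q}^*$ is determined by its value on $f_e$, since $\delta_w\odot f_e=f_{\overline w}$. $W$ acts on $\mathtt{h}_T(G/Q\times G/P)$ via $N_G(T)$ on the Borel construction. A class $a\in\mathtt{h}_T(G/Q\times G/P)^W$ induces the $W$-equivariant map $a_*\colon\mathtt{h}_T(G/Q)\to\mathtt{h}_T(G/P)$, $a_*(x)=p_{P*}(a\cdot p_Q^*(x))$ ($p_P,p_Q$ the projections of $G/Q\times G/P$); restriction to $T$-fixed points embeds $\mathtt{h}_T(G/P)$ in $\mathcal{Q}_{W/W_P}^*$ (a class goes to $\sum_{v\in W^P}(\text{its restriction at } vP)f_v$), and extending scalars to $\mathcal{Q}$ gives an embedding $\mathtt{h}_T(G/Q\times G/P)^W\hookrightarrow\operatorname{Hom}_{\mathcal{Q}_W}(\mathcal{Q}_{W/W_Q}^*,\mathcal{Q}_{W/W_P}^* )$. Under it the correspondence product $\psi\circ\phi=pr_{Q,H*}(pr_{P,H}^*(\psi)\cdot pr_{Q,P}^*(\phi))$ (projections from $G/Q\times G/P\times G/H$) corresponds to composition of homomorphisms. *)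

theory Defs
  imports Main "HOL-Library.Poly_Mapping"
begin

section \<open>Power series in arbitrarily many variables\<close>

text \<open>
  A monomial in variables indexed by \<open>'a\<close> is a finitely supported map \<open>'a \<Rightarrow>\<^sub>0 nat\<close>.  The
  completion of the polynomial ring \<open>R[x\<^sub>i]\<close> at the augmentation ideal \<open>I\<close> (all \<open>x\<^sub>i \<mapsto> 0\<close>) is the
  inverse limit of the \<open>R[x\<^sub>i] / I\<^sup>n\<close>.  Its elements are the families of coefficients with only
  finitely many nonzero entries \<^emph>\<open>in each degree\<close>; for an infinite index type this is a proper
  subset of all families of coefficients.
\<close>

definition mdeg :: "('a \<Rightarrow>\<^sub>0 nat) \<Rightarrow> nat"
  where "mdeg m = (\<Sum>i\<in>Poly_Mapping.keys m. Poly_Mapping.lookup m i)"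

lemma mdeg_superset:
  assumes "finite A" "Poly_Mapping.keys m \<subseteq> A"
  shows "mdeg m = (\<Sum>i\<in>A. Poly_Mapping.lookup m i)"
  unfolding mdeg_def
  by (rule sum.mono_neutral_left) (use assms in \<open>auto simp: in_keys_iff\<close>)

lemma mdeg_plus: "mdeg (a + b) = mdeg a + mdeg b"
proof -
  let ?A = "Poly_Mapping.keys a \<union> Poly_Mapping.keys b"
  have "Poly_Mapping.keys (a + b) \<subseteq> ?A"
    by (rule Poly_Mapping.keys_add)
  then show ?thesis
    using mdeg_superset[of ?A "a + b"] mdeg_superset[of ?A a] mdeg_superset[of ?A b]
    by (simp add: lookup_add sum.distrib)
qed

lemma mdeg_zero [simp]: "mdeg 0 = 0"
  by (simp add: mdeg_def)

lemma mdeg_single [simp]: "mdeg (Poly_Mapping.single i n) = n"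
  by (simp add: mdeg_def)

lemma finite_monomial_splits: "finite {(a, b :: 'a \<Rightarrow>\<^sub>0 nat). a + b = m}"
proof -
  let ?B = "{g :: 'a \<Rightarrow> nat. \<forall>i. (i \<in> Poly_Mapping.keys m \<longrightarrow> g i \<in> {..mdeg m}) \<and>
    (i \<notin> Poly_Mapping.keys m \<longrightarrow> g i = 0)}"
  have fB: "finite ?B"
    by (rule finite_set_of_finite_funs) simp_all
  have le: "Poly_Mapping.lookup m i \<le> mdeg m" for i
    by (cases "i \<in> Poly_Mapping.keys m") (auto simp: mdeg_def in_keys_iff intro: member_le_sum)
  have "Poly_Mapping.lookup ` {a. \<exists>b. a + b = m} \<subseteq> ?B"
  proof (clarify, intro conjI impI)
    fix a b :: "'a \<Rightarrow>\<^sub>0 nat" and i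
    assume m: "m = a + b"
    show "Poly_Mapping.lookup a i \<in> {..mdeg (a + b)}"
      using le[of i] unfolding m by (simp add: lookup_add)
    assume "i \<notin> Poly_Mapping.keys (a + b)"
    then show "Poly_Mapping.lookup a i = 0"
      by (simp add: in_keys_iff lookup_add)
  qed
  then have "finite (Poly_Mapping.lookup ` {a. \<exists>b. a + b = m})"
    using fB finite_subset by blast
  then have "finite {a. \<exists>b. a + b = m}"
    by (rule finite_imageD) (simp add: inj_on_def poly_mapping_eqI)
  then have "finite ((\<lambda>a. (a, m - a)) ` {a. \<exists>b. a + b = m})"
    by simp
  moreover have "{(a, b). a + b = m} \<subseteq> (\<lambda>a. (a, m - a)) ` {a. \<exists>b. a + b = m}"
    by force
  ultimately show ?thesis
    using finite_subset by blast
qed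

definition degreewise_finite :: "(('a \<Rightarrow>\<^sub>0 nat) \<Rightarrow> 'r::zero) \<Rightarrow> bool"
  where "degreewise_finite f \<longleftrightarrow> (\<forall>d. finite {m. mdeg m = d \<and> f m \<noteq> 0})"

typedef (overloaded) ('a, 'r::zero) mps = "{f :: ('a \<Rightarrow>\<^sub>0 nat) \<Rightarrow> 'r. degreewise_finite f}"
  morphisms coeff Abs_mps
  by (rule exI[of _ "\<lambda>_. 0"]) (simp add: degreewise_finite_def)

setup_lifting type_definition_mps

lemma finite_coeff: "finite {m. mdeg m = d \<and> coeff f m \<noteq> 0}"
  using coeff[of f] by (simp add: degreewise_finite_def)

lemma mps_eqI: "(\<And>m. coeff f m = coeff g m) \<Longrightarrow> f = g"
  by (simp add: coeff_inject[symmetric] fun_eq_iff)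

instantiation mps :: (type, comm_ring_1) comm_ring_1
begin

lift_definition zero_mps :: "('a, 'b) mps" is "\<lambda>_. 0"
  by (simp add: degreewise_finite_def)

lift_definition one_mps :: "('a, 'b) mps" is "\<lambda>m. if m = 0 then 1 else 0"
proof -
  have "finite {m :: 'a \<Rightarrow>\<^sub>0 nat. mdeg m = d \<and> (if m = 0 then 1 else 0 :: 'b) \<noteq> 0}" for d
    by (rule finite_subset[of _ "{0}"]) (auto split: if_splits)
  then show "degreewise_finite (\<lambda>m :: 'a \<Rightarrow>\<^sub>0 nat. (if m = 0 then 1 else 0 :: 'b))"
    by (simp add: degreewise_finite_def)
qed

lift_definition plus_mps :: "('a, 'b) mps \<Rightarrow> ('a, 'b) mps \<Rightarrow> ('a, 'b) mps"
  is "\<lambda>f g m. f m + g m"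
proof -
  fix f g :: "('a \<Rightarrow>\<^sub>0 nat) \<Rightarrow> 'b"
  assume "degreewise_finite f" "degreewise_finite g"
  then have f: "\<And>d. finite {m. mdeg m = d \<and> f m \<noteq> 0}"
    and g: "\<And>d. finite {m. mdeg m = d \<and> g m \<noteq> 0}"
    by (simp_all add: degreewise_finite_def)
  have "finite {m. mdeg m = d \<and> f m + g m \<noteq> 0}" for d
    by (rule finite_subset[of _ "{m. mdeg m = d \<and> f m \<noteq> 0} \<union> {m. mdeg m = d \<and> g m \<noteq> 0}"])
      (use f g in auto)
  then show "degreewise_finite (\<lambda>m. f m + g m)"
    by (simp add: degreewise_finite_def)
qed

lift_definition uminus_mps :: "('a, 'b) mps \<Rightarrow> ('a, 'b) mps"
  is "\<lambda>f m. - f m"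
  by (simp add: degreewise_finite_def)

definition minus_mps :: "('a, 'b) mps \<Rightarrow> ('a, 'b) mps \<Rightarrow> ('a, 'b) mps"
  where "minus_mps f g = f + - g"

lift_definition times_mps :: "('a, 'b) mps \<Rightarrow> ('a, 'b) mps \<Rightarrow> ('a, 'b) mps"
  is "\<lambda>f g m. \<Sum>(a, b)\<in>{(a, b). a + b = m}. f a * g b"
proof -
  fix f g :: "('a \<Rightarrow>\<^sub>0 nat) \<Rightarrow> 'b"
  assume "degreewise_finite f" "degreewise_finite g"
  then have f: "\<And>d. finite {m. mdeg m = d \<and> f m \<noteq> 0}"
    and g: "\<And>d. finite {m. mdeg m = d \<and> g m \<noteq> 0}"
    by (simp_all add: degreewise_finite_def)
  have "finite {m. mdeg m = d \<and> (\<Sum>(a, b)\<in>{(a, b). a + b = m}. f a * g b) \<noteq> 0}" for d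
  proof -
    let ?U = "\<Union>i\<in>{..d}. \<Union>j\<in>{..d}.
      (\<lambda>(a, b). a + b) ` ({a. mdeg a = i \<and> f a \<noteq> 0} \<times> {b. mdeg b = j \<and> g b \<noteq> 0})"
    have "finite ?U"
      using f g by (intro finite_UN_I finite_imageI finite_cartesian_product) auto
    moreover have "{m. mdeg m = d \<and> (\<Sum>(a, b)\<in>{(a, b). a + b = m}. f a * g b) \<noteq> 0} \<subseteq> ?U"
    proof clarify
      fix m
      assume d: "d = mdeg m" and "(\<Sum>(a, b)\<in>{(a, b). a + b = m}. f a * g b) \<noteq> 0"
      then obtain p where "p \<in> {(a, b). a + b = m}" "(case p of (a, b) \<Rightarrow> f a * g b) \<noteq> 0"
        by (elim sum.not_neutral_contains_not_neutral)
      then obtain a b where ab: "a + b = m" "f a * g b \<noteq> 0"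
        by auto
      then have "f a \<noteq> 0" "g b \<noteq> 0" by auto
      moreover have "mdeg a \<le> mdeg m" "mdeg b \<le> mdeg m"
        using ab(1) mdeg_plus[of a b] by auto
      ultimately show "m \<in> (\<Union>i\<in>{..mdeg m}. \<Union>j\<in>{..mdeg m}.
          (\<lambda>(a, b). a + b) ` ({a. mdeg a = i \<and> f a \<noteq> 0} \<times> {b. mdeg b = j \<and> g b \<noteq> 0}))"
        using ab(1) by (intro UN_I[of "mdeg a"] UN_I[of "mdeg b"]) auto
    qed
    ultimately show ?thesis
      by (rule rev_finite_subset)
  qed
  then show "degreewise_finite (\<lambda>m. \<Sum>(a, b)\<in>{(a, b). a + b = m}. f a * g b)"
    by (simp add: degreewise_finite_def)
qed

instance
proof
  fix f g h :: "('a, 'b) mps"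
  show "f + g + h = f + (g + h)" by transfer (simp add: add.assoc)
  show "f + g = g + f" by transfer (simp add: add.commute)
  show "0 + f = f" by transfer simp
  show "- f + f = 0" by transfer simp
  show "f - g = f + - g" by (rule minus_mps_def)
  show "f * g = g * f"
  proof (rule mps_eqI)
    fix m :: "'a \<Rightarrow>\<^sub>0 nat"
    show "coeff (f * g) m = coeff (g * f) m"
      unfolding times_mps.rep_eq
      by (rule sum.reindex_bij_witness[of _ "\<lambda>(a, b). (b, a)" "\<lambda>(a, b). (b, a)"])
        (auto simp: add.commute mult.commute)
  qed
  show "f * g * h = f * (g * h)"
  proof (rule mps_eqI)
    fix m :: "'a \<Rightarrow>\<^sub>0 nat"
    let ?S = "\<lambda>m :: 'a \<Rightarrow>\<^sub>0 nat. {(a, b). a + b = m}"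
    have fin: "finite (?S n)" for n
      by (rule finite_monomial_splits)
    have "coeff (f * g * h) m =
        (\<Sum>x\<in>?S m. \<Sum>y\<in>?S (fst x). coeff f (fst y) * coeff g (snd y) * coeff h (snd x))"
      by (simp add: times_mps.rep_eq sum_distrib_right case_prod_unfold)
    also have "\<dots> = (\<Sum>(x, y)\<in>Sigma (?S m) (\<lambda>x. ?S (fst x)).
        coeff f (fst y) * coeff g (snd y) * coeff h (snd x))"
      by (rule sum.Sigma) (use fin in auto)
    also have "\<dots> = (\<Sum>(x, y)\<in>Sigma (?S m) (\<lambda>x. ?S (snd x)).
        coeff f (fst x) * (coeff g (fst y) * coeff h (snd y)))"
      by (rule sum.reindex_bij_witness
          [of _ "\<lambda>((a, _), (b, c)). ((a + b, c), (a, b))" "\<lambda>((_, c), (a, b)). ((a, b + c), (b, c))"])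
        (auto simp: ac_simps)
    also have "\<dots> = (\<Sum>x\<in>?S m. \<Sum>y\<in>?S (snd x). coeff f (fst x) * (coeff g (fst y) * coeff h (snd y)))"
      by (rule sum.Sigma[symmetric]) (use fin in auto)
    also have "\<dots> = coeff (f * (g * h)) m"
      by (simp add: times_mps.rep_eq sum_distrib_left case_prod_unfold)
    finally show "coeff (f * g * h) m = coeff (f * (g * h)) m" .
  qed
  show "1 * f = f"
  proof (rule mps_eqI)
    fix m :: "'a \<Rightarrow>\<^sub>0 nat"
    have "coeff (1 * f) m = (\<Sum>p\<in>{(a, b). a + b = m}. if p = (0, m) then coeff f m else 0)"
      unfolding times_mps.rep_eq
    proof (rule sum.cong)
      fix p
      assume "p \<in> {(a, b). a + b = m}"
      then obtain a b where p: "p = (a, b)" "a + b = m" by auto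
      show "(case p of (a, b) \<Rightarrow> coeff 1 a * coeff f b) = (if p = (0, m) then coeff f m else 0)"
        by (cases "a = 0") (use p in \<open>auto simp: one_mps.rep_eq\<close>)
    qed simp
    also have "\<dots> = coeff f m"
      by (simp add: finite_monomial_splits)
    finally show "coeff (1 * f) m = coeff f m" .
  qed
  show "(f + g) * h = f * h + g * h"
    by (rule mps_eqI)
      (simp add: times_mps.rep_eq plus_mps.rep_eq case_prod_unfold distrib_right sum.distrib)
  show "(0 :: ('a, 'b) mps) \<noteq> 1"
    by transfer (auto simp: fun_eq_iff)
qed

end

lift_definition X :: "'a \<Rightarrow> ('a, 'r::comm_ring_1) mps"
  is "\<lambda>i m. if m = Poly_Mapping.single i 1 then 1 else 0"
proof -
  fix i :: 'a
  have "finite {m. mdeg m = d \<and> (if m = Poly_Mapping.single i 1 then 1 else 0 :: 'r) \<noteq> 0}" for d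
    by (rule finite_subset[of _ "{Poly_Mapping.single i 1}"]) (auto split: if_splits)
  then show "degreewise_finite (\<lambda>m. (if m = Poly_Mapping.single i 1 then 1 else 0 :: 'r))"
    by (simp add: degreewise_finite_def)
qed

definition mps_polynomials :: "('a, 'r::comm_ring_1) mps set"
  where "mps_polynomials = {f. finite {m. coeff f m \<noteq> 0}}"

text \<open>
  The substitution \<open>x\<^sub>i \<mapsto> x\<^bsub>\<sigma>(i)\<^esub>\<close> for a bijection \<open>\<sigma>\<close> of the variables: the monomial \<open>m\<close> of
  the image comes from the monomial \<open>m \<circ> \<sigma>\<close>, which is \<open>map_key \<sigma> m\<close>.
\<close>

lift_definition mps_rename :: "('a \<Rightarrow> 'a) \<Rightarrow> ('a, 'r::comm_ring_1) mps \<Rightarrow> ('a, 'r) mps"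
  is "\<lambda>\<sigma> f m. if bij \<sigma> then f (Poly_Mapping.map_key \<sigma> m) else 0"
proof -
  fix \<sigma> :: "'a \<Rightarrow> 'a" and f :: "('a \<Rightarrow>\<^sub>0 nat) \<Rightarrow> 'r"
  assume "degreewise_finite f"
  then have f: "\<And>d. finite {m. mdeg m = d \<and> f m \<noteq> 0}"
    by (simp add: degreewise_finite_def)
  show "degreewise_finite (\<lambda>m. (if bij \<sigma> then f (Poly_Mapping.map_key \<sigma> m) else 0))"
  proof (cases "bij \<sigma>")
    case True
    then have inj: "inj \<sigma>" and surj: "surj \<sigma>"
      by (simp_all add: bij_is_inj bij_is_surj)
    have keys: "Poly_Mapping.keys m = \<sigma> ` Poly_Mapping.keys (Poly_Mapping.map_key \<sigma> m)" for m :: "'a \<Rightarrow>\<^sub>0 nat"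
      using surj by (auto simp: keys_map_key[OF inj])
    have deg: "mdeg (Poly_Mapping.map_key \<sigma> m) = mdeg m" for m
    proof -
      have "mdeg m = (\<Sum>i\<in>\<sigma> ` Poly_Mapping.keys (Poly_Mapping.map_key \<sigma> m). Poly_Mapping.lookup m i)"
        unfolding mdeg_def by (subst keys) (rule refl)
      also have "\<dots> = mdeg (Poly_Mapping.map_key \<sigma> m)"
        using inj by (simp add: mdeg_def sum.reindex[OF inj_on_subset[OF inj subset_UNIV]] map_key.rep_eq o_def)
      finally show ?thesis by simp
    qed
    have inj': "inj (Poly_Mapping.map_key \<sigma> :: ('a \<Rightarrow>\<^sub>0 nat) \<Rightarrow> _)"
    proof (rule injI, rule poly_mapping_eqI)
      fix m n :: "'a \<Rightarrow>\<^sub>0 nat" and k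
      assume eq: "Poly_Mapping.map_key \<sigma> m = Poly_Mapping.map_key \<sigma> n"
      obtain l where "k = \<sigma> l" using surj by blast
      then show "Poly_Mapping.lookup m k = Poly_Mapping.lookup n k"
        using arg_cong[OF eq, of "\<lambda>p. Poly_Mapping.lookup p l"] inj by (simp add: map_key.rep_eq)
    qed
    have "finite {m. mdeg m = d \<and> f (Poly_Mapping.map_key \<sigma> m) \<noteq> 0}" for d
    proof -
      have "{m. mdeg m = d \<and> f (Poly_Mapping.map_key \<sigma> m) \<noteq> 0} =
          Poly_Mapping.map_key \<sigma> -` {m. mdeg m = d \<and> f m \<noteq> 0}"
        using deg by auto
      then show ?thesis
        using finite_vimageI[OF f inj'] by simp
    qed
    with True show ?thesis by (simp add: degreewise_finite_def)
  qed (simp add: degreewise_finite_def)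
qed


section \<open>Formal group laws\<close>

text \<open>
  A power series \<open>F(x,y) = \<Sum> F i j x\<^sup>i y\<^sup>j\<close> is given by its coefficients.  \<open>F(f, g)\<close> is meant for
  series \<open>f\<close>, \<open>g\<close> with zero constant term, for which \<open>f\<^sup>i g\<^sup>j\<close> has no term of degree below
  \<open>i + j\<close>; hence the truncated sum.
\<close>

definition fgl_subst ::
  "(nat \<Rightarrow> nat \<Rightarrow> 'r::comm_ring_1) \<Rightarrow> ('a, 'r) mps \<Rightarrow> ('a, 'r) mps \<Rightarrow> ('a, 'r) mps"
  where "fgl_subst F f g = Abs_mps (\<lambda>m. \<Sum>(i, j)\<in>{(i, j). i + j \<le> mdeg m}. F i j * coeff (f ^ i * g ^ j) m)"

lemma finite_pairs_sum_le: "finite {(i, j :: nat). i + j \<le> d}"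
  by (rule finite_subset[of _ "{..d} \<times> {..d}"]) auto

lemma coeff_fgl_subst:
  "coeff (fgl_subst F f g) m = (\<Sum>(i, j)\<in>{(i, j). i + j \<le> mdeg m}. F i j * coeff (f ^ i * g ^ j) m)"
proof -
  let ?h = "\<lambda>m. \<Sum>(i, j)\<in>{(i, j). i + j \<le> mdeg m}. F i j * coeff (f ^ i * g ^ j) m"
  have "finite {m. mdeg m = d \<and> ?h m \<noteq> 0}" for d
  proof (rule finite_subset)
    show "finite (\<Union>(i, j)\<in>{(i, j). i + j \<le> d}. {m. mdeg m = d \<and> coeff (f ^ i * g ^ j) m \<noteq> 0})"
      using finite_pairs_sum_le[of d] finite_coeff by (auto intro!: finite_UN_I)
    show "{m. mdeg m = d \<and> ?h m \<noteq> 0} \<subseteq>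
        (\<Union>(i, j)\<in>{(i, j). i + j \<le> d}. {m. mdeg m = d \<and> coeff (f ^ i * g ^ j) m \<noteq> 0})"
    proof clarify
      fix m
      assume "?h m \<noteq> 0"
      then obtain p where "p \<in> {(i, j). i + j \<le> mdeg m}"
        "(case p of (i, j) \<Rightarrow> F i j * coeff (f ^ i * g ^ j) m) \<noteq> 0"
        by (elim sum.not_neutral_contains_not_neutral)
      then show "m \<in> (\<Union>(i, j)\<in>{(i, j). i + j \<le> mdeg m}.
          {n. mdeg n = mdeg m \<and> coeff (f ^ i * g ^ j) n \<noteq> 0})"
        by (intro UN_I[of p]) auto
    qed
  qed
  then show ?thesis
    unfolding fgl_subst_def by (subst Abs_mps_inverse) (auto simp: degreewise_finite_def)
qed

definition formal_group_law :: "(nat \<Rightarrow> nat \<Rightarrow> 'r::comm_ring_1) \<Rightarrow> bool"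
  where "formal_group_law F \<longleftrightarrow>
    (\<forall>i. F i 0 = (if i = 1 then 1 else 0)) \<and>
    (\<forall>i j. F i j = F j i) \<and>
    fgl_subst F (fgl_subst F (X 0) (X 1)) (X 2) =
      fgl_subst F (X 0) (fgl_subst F (X 1) (X 2) :: (nat, 'r) mps)"

definition polynomial_fgl :: "(nat \<Rightarrow> nat \<Rightarrow> 'r::zero) \<Rightarrow> bool"
  where "polynomial_fgl F \<longleftrightarrow> finite {(i, j). F i j \<noteq> 0}"


section \<open>Semisimple root data\<close>

definition zscale :: "int \<Rightarrow> 'l::ab_group_add \<Rightarrow> 'l"
  where "zscale n x = (if 0 \<le> n then (((+) x) ^^ nat n) 0 else - (((+) x) ^^ nat (- n)) 0)"

text \<open>
  The character lattice \<open>T\<^sup>*\<close> is the type \<open>'l\<close>; the coroot of \<open>\<alpha>\<close> is given as the functional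
  \<open>\<lambda> \<mapsto> \<langle>\<lambda>, \<alpha>\<^sup>\<or>\<rangle>\<close>.  The set \<open>simple\<close> is the set of simple roots determined by the Borel
  subgroup.
\<close>

record 'l based_root_datum =
  roots :: "'l set"
  coroot :: "'l \<Rightarrow> 'l \<Rightarrow> int"
  simple :: "'l set"

definition reflection :: "('l::ab_group_add, 'z) based_root_datum_scheme \<Rightarrow> 'l \<Rightarrow> 'l \<Rightarrow> 'l"
  where "reflection D \<alpha> x = x - zscale (coroot D \<alpha> x) \<alpha>"

definition free_lattice :: "'l::ab_group_add itself \<Rightarrow> bool"
  where "free_lattice _ \<longleftrightarrow> (\<exists>E :: 'l set. finite E \<and>
    (\<forall>x. \<exists>!c. (\<forall>e. e \<notin> E \<longrightarrow> c e = 0) \<and> x = (\<Sum>e\<in>E. zscale (c e) e)))"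

text \<open>Reduced root data of split semisimple groups: the roots span \<open>T\<^sup>*\<close> rationally.\<close>

definition semisimple_root_datum :: "('l::ab_group_add, 'z) based_root_datum_scheme \<Rightarrow> bool"
  where "semisimple_root_datum D \<longleftrightarrow>
    free_lattice TYPE('l) \<and>
    finite (roots D) \<and>
    (\<forall>\<alpha>\<in>roots D. \<forall>x y. coroot D \<alpha> (x + y) = coroot D \<alpha> x + coroot D \<alpha> y) \<and>
    inj_on (coroot D) (roots D) \<and>
    (\<forall>\<alpha>\<in>roots D. coroot D \<alpha> \<alpha> = 2) \<and>
    (\<forall>\<alpha>\<in>roots D. \<forall>\<beta>\<in>roots D. reflection D \<alpha> \<beta> \<in> roots D) \<and>
    (\<forall>\<alpha>\<in>roots D. \<forall>\<beta>\<in>roots D. \<exists>\<gamma>\<in>roots D. \<forall>x.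
      coroot D \<gamma> x = coroot D \<beta> x - coroot D \<beta> \<alpha> * coroot D \<alpha> x) \<and>
    (\<forall>\<alpha>\<in>roots D. \<forall>n. zscale n \<alpha> \<in> roots D \<longrightarrow> n = 1 \<or> n = - 1) \<and>
    (\<forall>x. \<exists>n>0. \<exists>c. zscale n x = (\<Sum>\<alpha>\<in>roots D. zscale (c \<alpha>) \<alpha>))"

definition is_base :: "('l::ab_group_add, 'z) based_root_datum_scheme \<Rightarrow> bool"
  where "is_base D \<longleftrightarrow>
    simple D \<subseteq> roots D \<and>
    (\<forall>c. (\<Sum>\<beta>\<in>simple D. zscale (c \<beta>) \<beta>) = 0 \<longrightarrow> (\<forall>\<beta>\<in>simple D. c \<beta> = 0)) \<and>
    (\<forall>\<alpha>\<in>roots D. \<exists>c. \<alpha> = (\<Sum>\<beta>\<in>simple D. zscale (c \<beta>) \<beta>) \<and>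
      ((\<forall>\<beta>\<in>simple D. c \<beta> \<ge> 0) \<or> (\<forall>\<beta>\<in>simple D. c \<beta> \<le> 0)))"

text \<open>The group generated by the reflections in \<open>A\<close>; as these are involutions, closing under
  multiplication by generators suffices.\<close>

inductive_set refl_group :: "('l::ab_group_add, 'z) based_root_datum_scheme \<Rightarrow> 'l set \<Rightarrow> ('l \<Rightarrow> 'l) set"
  for D :: "('l::ab_group_add, 'z) based_root_datum_scheme" and A :: "'l set" where
  id: "id \<in> refl_group D A"
| step: "\<alpha> \<in> A \<Longrightarrow> w \<in> refl_group D A \<Longrightarrow> reflection D \<alpha> \<circ> w \<in> refl_group D A"

abbreviation weyl :: "('l::ab_group_add, 'z) based_root_datum_scheme \<Rightarrow> ('l \<Rightarrow> 'l) set"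
  where "weyl D \<equiv> refl_group D (roots D)"

definition weyl_length :: "('l::ab_group_add, 'z) based_root_datum_scheme \<Rightarrow> ('l \<Rightarrow> 'l) \<Rightarrow> nat"
  where "weyl_length D w = (LEAST n. \<exists>\<beta>s. length \<beta>s = n \<and> set \<beta>s \<subseteq> simple D \<and>
    w = List.foldr (\<lambda>\<beta> u. reflection D \<beta> \<circ> u) \<beta>s id)"

text \<open>
  A standard parabolic subgroup \<open>P\<close> is given by a set \<open>I\<close> of simple roots (those of its Levi
  part), so that \<open>W\<^sub>P\<close> is \<open>refl_group D I\<close>.  The following are the coset \<open>w W\<^sub>P\<close>, the quotient
  \<open>W / W\<^sub>P\<close>, the set \<open>W\<^sup>P\<close>, and the representative of the coset of \<open>w\<close> in \<open>W\<^sup>P\<close>.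
\<close>

definition par_coset ::
  "('l::ab_group_add, 'z) based_root_datum_scheme \<Rightarrow> 'l set \<Rightarrow> ('l \<Rightarrow> 'l) \<Rightarrow> ('l \<Rightarrow> 'l) set"
  where "par_coset D I w = (\<lambda>u. w \<circ> u) ` refl_group D I"

definition par_quotient ::
  "('l::ab_group_add, 'z) based_root_datum_scheme \<Rightarrow> 'l set \<Rightarrow> ('l \<Rightarrow> 'l) set set"
  where "par_quotient D I = par_coset D I ` weyl D"

definition min_reps ::
  "('l::ab_group_add, 'z) based_root_datum_scheme \<Rightarrow> 'l set \<Rightarrow> ('l \<Rightarrow> 'l) set"
  where "min_reps D I =
    {w \<in> weyl D. \<forall>w'\<in>par_coset D I w. weyl_length D w \<le> weyl_length D w'}"

definition min_rep ::
  "('l::ab_group_add, 'z) based_root_datum_scheme \<Rightarrow> 'l set \<Rightarrow> ('l \<Rightarrow> 'l) \<Rightarrow> 'l \<Rightarrow> 'l"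
  where "min_rep D I w = (THE v. v \<in> min_reps D I \<and> v \<in> par_coset D I w)"


section \<open>The rings \<open>S\<close> and \<open>\<Q>\<close>\<close>

definition ring_hom_on :: "'a::comm_ring_1 set \<Rightarrow> ('a \<Rightarrow> 'b::comm_ring_1) \<Rightarrow> bool"
  where "ring_hom_on C h \<longleftrightarrow> h 1 = 1 \<and>
    (\<forall>x\<in>C. \<forall>y\<in>C. h (x + y) = h x + h y) \<and> (\<forall>x\<in>C. \<forall>y\<in>C. h (x * y) = h x * h y)"

text \<open>
  \<open>S\<close> is the quotient of \<open>R[[x\<^sub>\<lambda>]]\<close>, or of its subring \<open>R[x\<^sub>\<lambda>]\<close> in the polynomial case
  (\<open>pol = True\<close>), by the closure of the ideal generated by the relations.  The closure is taken
  for the topology of the powers of the augmentation ideal, in which a neighbourhood of \<open>f\<close>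
  consists of the series agreeing with \<open>f\<close> below a given degree.
\<close>

definition fg_ambient :: "bool \<Rightarrow> ('l, 'r::comm_ring_1) mps set"
  where "fg_ambient pol = (if pol then mps_polynomials else UNIV)"

definition fg_relations ::
  "(nat \<Rightarrow> nat \<Rightarrow> 'r::comm_ring_1) \<Rightarrow> ('l::ab_group_add, 'r) mps set"
  where "fg_relations F = insert (X 0) {X (x + y) - fgl_subst F (X x) (X y) | x y. True}"

definition ideal_generated :: "'a::comm_ring_1 set \<Rightarrow> 'a set \<Rightarrow> 'a set"
  where "ideal_generated C K =
    {(\<Sum>k\<in>A. c k * k) | A c. finite A \<and> A \<subseteq> K \<and> c ` A \<subseteq> C}"

definition adic_closure :: "('l, 'r::comm_ring_1) mps set \<Rightarrow> ('l, 'r) mps set \<Rightarrow> ('l, 'r) mps set"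
  where "adic_closure C K =
    {f \<in> C. \<forall>n. \<exists>g\<in>K. \<forall>m. mdeg m < n \<longrightarrow> coeff f m = coeff g m}"

text \<open>
  The quotient is given by its projection \<open>\<pi>\<close> onto the ring type \<open>'s\<close>, which exhibits \<open>'s\<close> as
  the quotient ring; \<open>\<pi>\<close> is only relevant on the ambient ring.
\<close>

definition formal_group_ring ::
  "bool \<Rightarrow> (nat \<Rightarrow> nat \<Rightarrow> 'r::comm_ring_1) \<Rightarrow> (('l::ab_group_add, 'r) mps \<Rightarrow> 's::comm_ring_1) \<Rightarrow> bool"
  where "formal_group_ring pol F \<pi> \<longleftrightarrow>
    ring_hom_on (fg_ambient pol) \<pi> \<and>
    \<pi> ` fg_ambient pol = UNIV \<and>
    {f \<in> fg_ambient pol. \<pi> f = 0} =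
      adic_closure (fg_ambient pol) (ideal_generated (fg_ambient pol) (fg_relations F))"

definition root_regular ::
  "('l::ab_group_add, 'z) based_root_datum_scheme \<Rightarrow> (('l, 'r::comm_ring_1) mps \<Rightarrow> 's::comm_ring_1) \<Rightarrow> bool"
  where "root_regular D \<pi> \<longleftrightarrow> (\<forall>\<alpha>\<in>roots D. \<forall>s. \<pi> (X \<alpha>) * s = 0 \<longrightarrow> s = 0)"

definition root_denominators ::
  "('l::ab_group_add, 'z) based_root_datum_scheme \<Rightarrow> (('l, 'r::comm_ring_1) mps \<Rightarrow> 's::comm_ring_1) \<Rightarrow> 's set"
  where "root_denominators D \<pi> = {(\<Prod>\<alpha>\<in>roots D. \<pi> (X \<alpha>) ^ n \<alpha>) | n. True}"

text \<open>\<open>\<iota>\<close> exhibits its codomain as the localization of its domain at the multiplicative set \<open>M\<close>.\<close>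

definition is_localization :: "'s::comm_ring_1 set \<Rightarrow> ('s \<Rightarrow> 'q::comm_ring_1) \<Rightarrow> bool"
  where "is_localization M \<iota> \<longleftrightarrow>
    ring_hom_on UNIV \<iota> \<and>
    (\<forall>d\<in>M. \<iota> d dvd 1) \<and>
    (\<forall>q. \<exists>s. \<exists>d\<in>M. q * \<iota> d = \<iota> s) \<and>
    (\<forall>s. \<iota> s = 0 \<longleftrightarrow> (\<exists>d\<in>M. d * s = 0))"

text \<open>
  The action \<open>w(x\<^sub>\<lambda>) = x\<^bsub>w(\<lambda>)\<^esub>\<close> of the Weyl group on \<open>S\<close> is induced by the permutation of the
  variables; on \<open>\<Q>\<close> it is the unique extension to a ring endomorphism.
\<close>

definition act_S ::
  "bool \<Rightarrow> (('l, 'r::comm_ring_1) mps \<Rightarrow> 's::comm_ring_1) \<Rightarrow> ('l \<Rightarrow> 'l) \<Rightarrow> 's \<Rightarrow> 's"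
  where "act_S pol \<pi> w = (THE \<sigma>. \<forall>f\<in>fg_ambient pol. \<sigma> (\<pi> f) = \<pi> (mps_rename w f))"

definition act_Q ::
  "bool \<Rightarrow> (('l, 'r::comm_ring_1) mps \<Rightarrow> 's::comm_ring_1) \<Rightarrow> ('s \<Rightarrow> 'q::comm_ring_1) \<Rightarrow>
    ('l \<Rightarrow> 'l) \<Rightarrow> 'q \<Rightarrow> 'q"
  where "act_Q pol \<pi> \<iota> w = (THE \<sigma>. ring_hom_on UNIV \<sigma> \<and> (\<forall>s. \<sigma> (\<iota> s) = \<iota> (act_S pol \<pi> w s)))"


section \<open>The twisted group algebra and its modules\<close>

text \<open>
  In this section \<open>act\<close> is an action of the Weyl group on \<open>\<Q>\<close>.  Elements of the free modules
  \<open>\<Q>\<^sub>W\<close> and \<open>\<Q>\<^bsub>W/W\<^sub>P\<^esub>\<close> are finitely supported functions, with \<open>\<delta>\<^sub>x\<close> being \<open>Poly_Mapping.single x 1\<close>.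
\<close>

definition QW :: "('l::ab_group_add, 'z) based_root_datum_scheme \<Rightarrow> (('l \<Rightarrow> 'l) \<Rightarrow>\<^sub>0 'q::comm_ring_1) set"
  where "QW D = {a. Poly_Mapping.keys a \<subseteq> weyl D}"

definition QW_mult ::
  "(('l \<Rightarrow> 'l) \<Rightarrow> 'q \<Rightarrow> 'q) \<Rightarrow> (('l \<Rightarrow> 'l) \<Rightarrow>\<^sub>0 'q::comm_ring_1) \<Rightarrow> (('l \<Rightarrow> 'l) \<Rightarrow>\<^sub>0 'q) \<Rightarrow> (('l \<Rightarrow> 'l) \<Rightarrow>\<^sub>0 'q)"
  where "QW_mult act a b = (\<Sum>w\<in>Poly_Mapping.keys a. \<Sum>w'\<in>Poly_Mapping.keys b.
    Poly_Mapping.single (w \<circ> w') (Poly_Mapping.lookup a w * act w (Poly_Mapping.lookup b w')))"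

definition QWP ::
  "('l::ab_group_add, 'z) based_root_datum_scheme \<Rightarrow> 'l set \<Rightarrow> (('l \<Rightarrow> 'l) set \<Rightarrow>\<^sub>0 'q::comm_ring_1) set"
  where "QWP D I = {m. Poly_Mapping.keys m \<subseteq> par_quotient D I}"

text \<open>
  \<open>\<Q>\<close>-linear functionals on \<open>\<Q>\<^bsub>W/W\<^sub>P\<^esub>\<close>, extended by \<open>0\<close> outside this set so that equality of
  functionals is equality of functions.
\<close>

definition QWP_dual ::
  "('l::ab_group_add, 'z) based_root_datum_scheme \<Rightarrow> 'l set \<Rightarrow>
    ((('l \<Rightarrow> 'l) set \<Rightarrow>\<^sub>0 'q::comm_ring_1) \<Rightarrow> 'q) set"
  where "QWP_dual D I = {\<xi>.
    (\<forall>m\<in>QWP D I. \<forall>n\<in>QWP D I. \<xi> (m + n) = \<xi> m + \<xi> n) \<and>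
    (\<forall>q. \<forall>m\<in>QWP D I. \<xi> (Poly_Mapping.map (\<lambda>x. q * x) m) = q * \<xi> m) \<and>
    (\<forall>m. m \<notin> QWP D I \<longrightarrow> \<xi> m = 0)}"

definition dual_basis ::
  "('l::ab_group_add, 'z) based_root_datum_scheme \<Rightarrow> 'l set \<Rightarrow> ('l \<Rightarrow> 'l) \<Rightarrow>
    (('l \<Rightarrow> 'l) set \<Rightarrow>\<^sub>0 'q::comm_ring_1) \<Rightarrow> 'q"
  where "dual_basis D I v m =
    (if m \<in> QWP D I then Poly_Mapping.lookup m (par_coset D I v) else 0)"

definition has_coordinates ::
  "('l::ab_group_add, 'z) based_root_datum_scheme \<Rightarrow> 'l set \<Rightarrow>
    ((('l \<Rightarrow> 'l) set \<Rightarrow>\<^sub>0 'q::comm_ring_1) \<Rightarrow> 'q) \<Rightarrow> (('l \<Rightarrow> 'l) \<Rightarrow> 'q) \<Rightarrow> bool"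
  where "has_coordinates D I \<xi> b \<longleftrightarrow> \<xi> = (\<lambda>m. \<Sum>v\<in>min_reps D I. b v * dual_basis D I v m)"

text \<open>
  The action \<open>(p \<delta>\<^sub>w) \<odot> (q f\<^sub>v) = p w(q) f\<^bsub>wv\<^esub>\<close>, extended additively; the coefficient of \<open>f\<^sub>v\<close>
  in \<open>\<xi>\<close> is \<open>\<xi>(\<delta>\<^sub>v)\<close>.
\<close>

definition QW_act ::
  "('l::ab_group_add, 'z) based_root_datum_scheme \<Rightarrow> (('l \<Rightarrow> 'l) \<Rightarrow> 'q \<Rightarrow> 'q) \<Rightarrow> 'l set \<Rightarrow>
    (('l \<Rightarrow> 'l) \<Rightarrow>\<^sub>0 'q) \<Rightarrow> ((('l \<Rightarrow> 'l) set \<Rightarrow>\<^sub>0 'q::comm_ring_1) \<Rightarrow> 'q) \<Rightarrow>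
    (('l \<Rightarrow> 'l) set \<Rightarrow>\<^sub>0 'q) \<Rightarrow> 'q"
  where "QW_act D act I a \<xi> = (\<lambda>m. \<Sum>w\<in>Poly_Mapping.keys a. \<Sum>v\<in>min_reps D I.
    Poly_Mapping.lookup a w * act w (\<xi> (Poly_Mapping.single (par_coset D I v) 1)) *
      dual_basis D I (min_rep D I (w \<circ> v)) m)"

text \<open>Homomorphisms of \<open>\<Q>\<^sub>W\<close>-modules from \<open>\<Q>\<^sup>*\<^bsub>W/W\<^sub>P\<^esub>\<close> to \<open>\<Q>\<^sup>*\<^bsub>W/W\<^bsub>P'\<^esub>\<^esub>\<close>, with \<open>P\<close>, \<open>P'\<close> given
  by \<open>I\<close>, \<open>I'\<close>.\<close>

definition QW_hom ::
  "('l::ab_group_add, 'z) based_root_datum_scheme \<Rightarrow> (('l \<Rightarrow> 'l) \<Rightarrow> 'q \<Rightarrow> 'q) \<Rightarrow> 'l set \<Rightarrow> 'l set \<Rightarrow>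
    (((('l \<Rightarrow> 'l) set \<Rightarrow>\<^sub>0 'q::comm_ring_1) \<Rightarrow> 'q) \<Rightarrow> ((('l \<Rightarrow> 'l) set \<Rightarrow>\<^sub>0 'q) \<Rightarrow> 'q)) set"
  where "QW_hom D act I I' = {\<phi>.
    \<phi> ` QWP_dual D I \<subseteq> QWP_dual D I' \<and>
    (\<forall>\<xi>\<in>QWP_dual D I. \<forall>\<eta>\<in>QWP_dual D I. \<phi> (\<lambda>m. \<xi> m + \<eta> m) = (\<lambda>m. \<phi> \<xi> m + \<phi> \<eta> m)) \<and>
    (\<forall>a\<in>QW D. \<forall>\<xi>\<in>QWP_dual D I. \<phi> (QW_act D act I a \<xi>) = QW_act D act I' a (\<phi> \<xi>))}"

end

theory Submission
  imports Defs "HOL.Modules" "HOL-Library.FuncSet"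
begin

text \<open>
  Writing \<open>\<phi>(f\<^sub>e) = (\<Sum>\<^sub>v b\<^sub>v \<delta>\<^sub>v) \<odot> f\<^sub>e\<close>, the \<open>\<Q>\<^sub>W\<close>-linearity of \<open>\<psi>\<close> gives
  \<open>\<psi>(\<phi>(f\<^sub>e)) = (\<Sum>\<^sub>v b\<^sub>v \<delta>\<^sub>v) \<odot> (\<Sum>\<^sub>u c\<^sub>u f\<^sub>u)\<close>, and the formula is the expansion of this product.
  For this the \<open>f\<^sub>v\<close> have to form a basis and \<open>W\<close> has to act on \<open>\<Q>\<close> by ring homomorphisms.
  The former is the uniqueness of minimal coset representatives: by the exchange property a
  minimal \<open>w\<close> sends the simple roots of the parabolic to positive roots, while every \<open>u \<noteq> 1\<close> in \<open>W\<^sub>P\<close>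
  sends one of them to a negative combination of them, so that \<open>wu\<close> is not minimal.  The latter
  holds because renaming variables preserves degrees and the relations defining \<open>S\<close>, and
  permutes the \<open>x\<^sub>\<alpha>\<close>.
\<close>

section \<open>The lattice\<close>

lemma zscale_zero [simp]: "zscale 0 x = 0"
  by (simp add: zscale_def)

lemma zscale_plus_one: "zscale (n + 1) x = zscale n x + x"
proof (cases "0 \<le> n")
  case True
  then show ?thesis
    by (simp add: zscale_def nat_add_distrib add.commute)
next
  case False
  define k where "k = nat (- (n + 1))"
  have k: "n + 1 = - int k" "nat (- n) = Suc k"
    using False by (simp_all add: k_def)
  show ?thesis
    by (cases "k = 0") (use False k in \<open>simp_all add: zscale_def algebra_simps\<close>)
qed

lemma zscale_minus_one: "zscale (n - 1) x = zscale n x - x"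
  using zscale_plus_one[of "n - 1" x] by (simp add: algebra_simps)

lemma zscale_one [simp]: "zscale 1 x = x"
  using zscale_plus_one[of 0 x] by simp

lemma zscale_add: "zscale (m + n) x = zscale m x + zscale n x"
proof (induction m rule: int_induct[where k = 0])
  case (step1 i)
  have "i + 1 + n = i + n + 1" by simp
  with step1 show ?case
    by (simp only: zscale_plus_one) (simp add: algebra_simps)
next
  case (step2 i)
  have "i - 1 + n = i + n - 1" by simp
  with step2 show ?case
    by (simp only: zscale_minus_one) (simp add: algebra_simps)
qed simp

interpretation zscale: module zscale
proof
  fix a b :: int and x y :: 'a
  show "zscale a (x + y) = zscale a x + zscale a y"
    by (induction a rule: int_induct[where k = 0])
      (simp_all add: zscale_plus_one zscale_minus_one algebra_simps)
  show "zscale (a + b) x = zscale a x + zscale b x"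
    by (rule zscale_add)
  show "zscale a (zscale b x) = zscale (a * b) x"
  proof (induction a rule: int_induct[where k = 0])
    case (step1 i)
    then show ?case
      by (simp add: zscale_plus_one zscale_add distrib_right)
  next
    case (step2 i)
    then show ?case
      using zscale_add[of "(i - 1) * b" b x]
      by (simp add: zscale_minus_one left_diff_distrib)
  qed simp
qed simp

text \<open>Lets \<open>additive_zscale\<close> also handle integer valued functionals such as
  coroots, where the scaling becomes a product.\<close>

lemma zscale_int: "zscale n k = n * k" for k :: int
  by (induction n rule: int_induct[where k = 0])
    (simp_all add: zscale_plus_one zscale_minus_one algebra_simps)

lemma additive_zscale:
  assumes "additive f"
  shows "f (zscale n x) = zscale n (f x)"
  by (induction n rule: int_induct[where k = 0])
    (simp_all add: zscale_plus_one zscale_minus_one additive.add[OF assms] additive.diff[OF assms]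
      additive.zero[OF assms])

lemma additive_comp: "additive f \<Longrightarrow> additive g \<Longrightarrow> additive (f \<circ> g)"
  by (simp add: additive_def)

text \<open>If \<open>c\<close> are the coordinates of \<open>x\<close>, then \<open>n * c\<close>
  and the zero family are both coordinates of 0, so uniqueness gives
  \<open>n * c = 0\<close>.\<close>

lemma free_lattice_torsion_free:
  assumes "free_lattice TYPE('l::ab_group_add)" "zscale n (x :: 'l) = 0" "n \<noteq> 0"
  shows "x = 0"
proof -
  obtain E :: "'l set" where E: "finite E"
    and ex1: "\<And>x. \<exists>!c. (\<forall>e. e \<notin> E \<longrightarrow> c e = 0) \<and> x = (\<Sum>e\<in>E. zscale (c e) e)"
    using assms(1) unfolding free_lattice_def by blast
  obtain c where c: "\<forall>e. e \<notin> E \<longrightarrow> c e = 0" "x = (\<Sum>e\<in>E. zscale (c e) e)"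
    using ex1 by blast
  have "0 = (\<Sum>e\<in>E. zscale (n * c e) e)"
    using assms(2) unfolding c(2) by (simp add: zscale.scale_sum_right)
  moreover have "0 = (\<Sum>e\<in>E. zscale ((\<lambda>_. 0) e) e)"
    by simp
  ultimately have "(\<lambda>e. n * c e) = (\<lambda>_. 0)"
    using ex1[of 0] c(1) by (elim alt_ex1E) auto
  then have "c e = 0" for e
    using assms(3) by (auto dest: fun_cong[of _ _ e])
  then show ?thesis
    using c(2) by simp
qed

section \<open>Reflections\<close>

locale based_datum =
  fixes D :: "('l::ab_group_add, 'z) based_root_datum_scheme"
  assumes semisimple: "semisimple_root_datum D" and base: "is_base D"
begin

abbreviation root_reflection ("\<s>") where "\<s> \<equiv> reflection D"

lemma finite_roots [simp]: "finite (roots D)"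
  using semisimple by (simp add: semisimple_root_datum_def)

lemma additive_coroot: "\<alpha> \<in> roots D \<Longrightarrow> additive (coroot D \<alpha>)"
  using semisimple by (simp add: semisimple_root_datum_def additive_def)

lemma coroot_self [simp]: "\<alpha> \<in> roots D \<Longrightarrow> coroot D \<alpha> \<alpha> = 2"
  using semisimple by (simp add: semisimple_root_datum_def)

lemma reflection_root: "\<alpha> \<in> roots D \<Longrightarrow> \<beta> \<in> roots D \<Longrightarrow> \<s> \<alpha> \<beta> \<in> roots D"
  using semisimple by (simp add: semisimple_root_datum_def)

lemma multiple_root: "\<alpha> \<in> roots D \<Longrightarrow> zscale n \<alpha> \<in> roots D \<Longrightarrow> n = 1 \<or> n = - 1"
  using semisimple unfolding semisimple_root_datum_def by blast

lemma roots_span: "\<exists>n>0. \<exists>c. zscale n x = (\<Sum>\<alpha>\<in>roots D. zscale (c \<alpha>) \<alpha>)"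
  using semisimple unfolding semisimple_root_datum_def by blast

lemma torsion_free: "zscale n (x :: 'l) = 0 \<Longrightarrow> n \<noteq> 0 \<Longrightarrow> x = 0"
  using semisimple free_lattice_torsion_free unfolding semisimple_root_datum_def by blast

lemma coroot_zscale: "\<alpha> \<in> roots D \<Longrightarrow> coroot D \<alpha> (zscale n x) = n * coroot D \<alpha> x"
  by (simp add: additive_zscale[OF additive_coroot] zscale_int)

lemmas coroot_linear =
  additive.add[OF additive_coroot] additive.diff[OF additive_coroot]
  additive.minus[OF additive_coroot] additive.zero[OF additive_coroot] coroot_zscale

text \<open>The roots span rationally: \<open>f\<close> and \<open>g\<close> agree on a positive
  multiple of any \<open>x\<close>, and a target without torsion permits dividing by the
  multiplier.\<close>

lemma additive_eqI:
  assumes "additive f" "additive g" "\<And>n y. zscale n (y :: 'b::ab_group_add) = 0 \<Longrightarrow> n \<noteq> 0 \<Longrightarrow> y = 0"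
    and "\<And>\<alpha>. \<alpha> \<in> roots D \<Longrightarrow> f \<alpha> = g \<alpha>"
  shows "f = (g :: 'l \<Rightarrow> 'b)"
proof
  fix x
  obtain n c where n: "n > 0" "zscale n x = (\<Sum>\<alpha>\<in>roots D. zscale (c \<alpha>) \<alpha>)"
    using roots_span by blast
  have "f (zscale n x) = g (zscale n x)"
    using assms(4) by (simp add: n(2) additive.sum[OF assms(1)] additive.sum[OF assms(2)]
        additive_zscale[OF assms(1)] additive_zscale[OF assms(2)])
  then have "zscale n (f x - g x) = 0"
    by (simp add: zscale.scale_right_diff_distrib additive_zscale[OF assms(1)]
        additive_zscale[OF assms(2)])
  then show "f x = g x"
    using assms(3)[of n "f x - g x"] n(1) by simp
qed

text \<open>
  The datum does not state that the coroot of \<open>s\<^sub>\<alpha> \<beta>\<close> is \<open>s\<^sub>\<alpha>\<^sup>\<or> \<beta>\<^sup>\<or>\<close>.  This follows because a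
  reflection preserving a finite spanning set is determined by the root it negates: the product
  of two such reflections is a transvection \<open>x \<mapsto> x + f(x) \<alpha>\<close>, whose orbits are infinite
  unless \<open>f\<close> vanishes.
\<close>

lemma coroot_unique:
  assumes \<alpha>: "\<alpha> \<in> roots D" and c: "additive c" "c \<alpha> = 2"
    and pres: "\<And>\<beta>. \<beta> \<in> roots D \<Longrightarrow> \<beta> - zscale (c \<beta>) \<alpha> \<in> roots D"
  shows "c = coroot D \<alpha>"
proof (rule additive_eqI[OF c(1) additive_coroot[OF \<alpha>]])
  fix \<beta> assume \<beta>: "\<beta> \<in> roots D"
  define f where "f x = coroot D \<alpha> x - c x" for x
  note c_linear = additive.add[OF c(1)] additive.diff[OF c(1)] additive_zscale[OF c(1)] zscale_int
  have step: "\<gamma> + zscale (f \<gamma>) \<alpha> \<in> roots D" if "\<gamma> \<in> roots D" for \<gamma>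
  proof -
    have "\<s> \<alpha> \<gamma> - zscale (c (\<s> \<alpha> \<gamma>)) \<alpha> \<in> roots D"
      by (intro pres reflection_root \<alpha> that)
    moreover have "\<s> \<alpha> \<gamma> - zscale (c (\<s> \<alpha> \<gamma>)) \<alpha> = \<gamma> + zscale (f \<gamma>) \<alpha>"
      using c(2) zscale_add[of "coroot D \<alpha> \<gamma>" "coroot D \<alpha> \<gamma>" \<alpha>]
      by (simp add: reflection_def f_def c_linear algebra_simps)
    ultimately show ?thesis by simp
  qed
  have f\<alpha>: "f (\<gamma> + zscale m \<alpha>) = f \<gamma>" for \<gamma> m
    using c(2) \<alpha> by (simp add: f_def c_linear coroot_linear)
  have iter: "\<beta> + zscale (int n * f \<beta>) \<alpha> \<in> roots D" for n
  proof (induction n)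
    case (Suc n)
    show ?case
      using step[OF Suc] by (simp add: f\<alpha> algebra_simps)
  qed (use \<beta> in simp)
  have "f \<beta> = 0"
  proof (rule ccontr)
    assume "f \<beta> \<noteq> 0"
    \<comment> \<open>Pairing with the coroot of \<alpha> turns the orbit into an arithmetic
      progression with step \<open>2 * f \<beta>\<close>, so its points are distinct.\<close>
    then have "inj (\<lambda>n. coroot D \<alpha> (\<beta> + zscale (int n * f \<beta>) \<alpha>))"
      using \<alpha> by (intro injI) (simp add: coroot_linear)
    then have "inj (\<lambda>n. \<beta> + zscale (int n * f \<beta>) \<alpha>)"
      by (auto simp: inj_def)
    then have "infinite (range (\<lambda>n. \<beta> + zscale (int n * f \<beta>) \<alpha>))"
      using finite_imageD by blast
    moreover have "range (\<lambda>n. \<beta> + zscale (int n * f \<beta>) \<alpha>) \<subseteq> roots D"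
      using iter by blast
    ultimately show False
      using finite_subset finite_roots by blast
  qed
  then show "c \<beta> = coroot D \<alpha> \<beta>"
    by (simp add: f_def)
qed (simp add: zscale_int)

lemma additive_reflection: "\<alpha> \<in> roots D \<Longrightarrow> additive (\<s> \<alpha>)"
  by (simp add: additive_def reflection_def coroot_linear algebra_simps)

lemma reflection_involution: "\<alpha> \<in> roots D \<Longrightarrow> \<s> \<alpha> (\<s> \<alpha> x) = x"
  using zscale_add[of "coroot D \<alpha> x" "coroot D \<alpha> x" \<alpha>]
  by (simp add: reflection_def coroot_linear algebra_simps)

lemmas reflection_linear =
  additive.diff[OF additive_reflection] additive.minus[OF additive_reflection]
  additive_zscale[OF additive_reflection]

lemma reflection_self: "\<alpha> \<in> roots D \<Longrightarrow> \<s> \<alpha> \<alpha> = - \<alpha>"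
  using zscale_add[of 1 1 \<alpha>] by (simp add: reflection_def)

lemma uminus_root: "\<alpha> \<in> roots D \<Longrightarrow> - \<alpha> \<in> roots D"
  using reflection_root[of \<alpha> \<alpha>] by (simp add: reflection_self)

text \<open>By \<open>coroot_unique\<close> the coroot changes sign together with the root, and the
  two signs cancel in the reflection.\<close>

lemma reflection_uminus_root: "\<alpha> \<in> roots D \<Longrightarrow> \<s> (- \<alpha>) = \<s> \<alpha>"
proof -
  assume \<alpha>: "\<alpha> \<in> roots D"
  have "(\<lambda>x. - coroot D \<alpha> x) = coroot D (- \<alpha>)"
    using \<alpha> by (intro coroot_unique uminus_root)
      (auto simp: additive_def coroot_linear reflection_root simp flip: reflection_def)
  then have "coroot D (- \<alpha>) x = - coroot D \<alpha> x" for x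
    by (rule fun_cong[OF sym])
  then show ?thesis
    by (simp add: reflection_def fun_eq_iff)
qed

lemma root_nonzero: "0 \<notin> roots D"
  using additive.zero[OF additive_coroot] coroot_self by force

text \<open>The functional \<open>coroot D \<beta> \<circ> \<s> \<alpha>\<close> belongs to the
  conjugate of \<open>\<s> \<beta>\<close> by \<open>\<s> \<alpha>\<close>. This conjugate preserves
  the roots, and the functional is 2 on \<open>\<s> \<alpha> \<beta>\<close>, so
  \<open>coroot_unique\<close> identifies it.\<close>

lemma coroot_reflection:
  assumes "\<alpha> \<in> roots D" "\<beta> \<in> roots D"
  shows "coroot D (\<s> \<alpha> \<beta>) (\<s> \<alpha> x) = coroot D \<beta> x"
proof -
  have "coroot D \<beta> \<circ> \<s> \<alpha> = coroot D (\<s> \<alpha> \<beta>)"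
  proof (rule coroot_unique)
    fix \<gamma> assume \<gamma>: "\<gamma> \<in> roots D"
    have "\<s> \<alpha> (\<s> \<beta> (\<s> \<alpha> \<gamma>)) \<in> roots D"
      by (intro reflection_root assms \<gamma>)
    then show "\<gamma> - zscale ((coroot D \<beta> \<circ> \<s> \<alpha>) \<gamma>) (\<s> \<alpha> \<beta>) \<in> roots D"
      using assms
      by (simp add: reflection_def[of D \<beta>] reflection_linear reflection_involution)
  qed (use assms in \<open>auto simp: reflection_root reflection_involution
      intro!: additive_comp additive_coroot additive_reflection\<close>)
  from fun_cong[OF this, of "\<s> \<alpha> x"] show ?thesis
    using assms by (simp add: reflection_involution)
qed

section \<open>The Weyl group\<close>

lemma refl_group_mono: "A \<subseteq> B \<Longrightarrow> w \<in> refl_group D A \<Longrightarrow> w \<in> refl_group D B"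
  by (rotate_tac, induction rule: refl_group.induct) (auto intro: refl_group.intros)

lemma refl_group_comp: "v \<in> refl_group D A \<Longrightarrow> w \<in> refl_group D A \<Longrightarrow> v \<circ> w \<in> refl_group D A"
  by (induction rule: refl_group.induct) (auto simp: comp_assoc intro: refl_group.intros)

lemma reflection_in_refl_group: "\<alpha> \<in> A \<Longrightarrow> \<s> \<alpha> \<in> refl_group D A"
  using refl_group.step[OF _ refl_group.id] by force

text \<open>The inductive set closes only under generators on the left; reflections being
  involutions, the inverse grows by the same reflections on the right.\<close>

lemma refl_group_inverse:
  assumes "w \<in> refl_group D A" "A \<subseteq> roots D"
  obtains u where "u \<in> refl_group D A" "u \<circ> w = id" "w \<circ> u = id"
proof -
  have "\<exists>u\<in>refl_group D A. u \<circ> w = id \<and> w \<circ> u = id"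
    using assms(1)
  proof induction
    case id
    show ?case
      by (intro bexI[of _ id] refl_group.id) simp
  next
    case (step \<alpha> w)
    then obtain u where "u \<in> refl_group D A" "u \<circ> w = id" "w \<circ> u = id"
      by blast
    then show ?case
      using step assms(2) by (intro bexI[of _ "u \<circ> \<s> \<alpha>"])
        (auto simp: fun_eq_iff reflection_involution subset_iff
          intro!: refl_group_comp reflection_in_refl_group)
  qed
  then show thesis
    using that by blast
qed

lemma bij_weyl: "w \<in> weyl D \<Longrightarrow> bij w"
  using o_bij refl_group_inverse by (metis order_refl)

lemma weyl_root: "w \<in> weyl D \<Longrightarrow> \<alpha> \<in> roots D \<Longrightarrow> w \<alpha> \<in> roots D"
  by (induction rule: refl_group.induct) (auto intro: reflection_root)

lemma additive_weyl: "w \<in> weyl D \<Longrightarrow> additive w"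
proof (induction rule: refl_group.induct)
  case (step \<alpha> w)
  then show ?case
    by (intro additive_comp additive_reflection)
qed (simp add: additive_def)

lemmas weyl_linear =
  additive.diff[OF additive_weyl] additive.minus[OF additive_weyl]
  additive.sum[OF additive_weyl] additive_zscale[OF additive_weyl]

lemma coroot_weyl: "w \<in> weyl D \<Longrightarrow> \<alpha> \<in> roots D \<Longrightarrow> coroot D (w \<alpha>) (w x) = coroot D \<alpha> x"
  by (induction rule: refl_group.induct) (auto simp: coroot_reflection weyl_root)

lemma reflection_weyl: "w \<in> weyl D \<Longrightarrow> \<alpha> \<in> roots D \<Longrightarrow> \<s> (w \<alpha>) \<circ> w = w \<circ> \<s> \<alpha>"
  by (simp add: fun_eq_iff reflection_def coroot_weyl weyl_linear)

lemma weyl_image_roots: "w \<in> weyl D \<Longrightarrow> w ` roots D = roots D"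
  by (intro endo_inj_surj finite_roots inj_on_subset[OF bij_is_inj[OF bij_weyl]])
    (auto intro: weyl_root)

text \<open>An additive map is determined by its values on the roots, and Weyl group elements map
  the finite set of roots to itself.\<close>

lemma finite_weyl: "finite (weyl D)"
proof (rule inj_on_finite)
  show "inj_on (\<lambda>w. restrict w (roots D)) (weyl D)"
  proof (rule inj_onI)
    fix v w assume "v \<in> weyl D" "w \<in> weyl D" "restrict v (roots D) = restrict w (roots D)"
    moreover from this have "v \<alpha> = w \<alpha>" if "\<alpha> \<in> roots D" for \<alpha>
      using that by (metis restrict_apply')
    ultimately show "v = w"
      using torsion_free by (intro additive_eqI additive_weyl) auto
  qed
  show "(\<lambda>w. restrict w (roots D)) ` weyl D \<subseteq> (\<Pi>\<^sub>E \<alpha>\<in>roots D. roots D)"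
    by (auto simp: weyl_root)
qed (simp add: finite_PiE)

section \<open>Positive roots\<close>

text \<open>Defined on the whole lattice and true at 0, so that it is closed under sums and
  nonnegative multiples; on roots it is positivity with respect to the base.\<close>

definition pos :: "'l \<Rightarrow> bool"
  where "pos x \<longleftrightarrow> (\<exists>c. (\<forall>\<beta>\<in>simple D. 0 \<le> c \<beta>) \<and> x = (\<Sum>\<beta>\<in>simple D. zscale (c \<beta>) \<beta>))"

lemma simple_root: "\<beta> \<in> simple D \<Longrightarrow> \<beta> \<in> roots D"
  using base by (auto simp: is_base_def)

lemma simple_subset: "simple D \<subseteq> roots D"
  using simple_root by blast

lemma finite_simple [simp]: "finite (simple D)"
  using finite_subset[OF simple_subset] by simp

lemma simple_coords_unique:
  assumes "(\<Sum>\<beta>\<in>simple D. zscale (c \<beta>) \<beta>) = (\<Sum>\<beta>\<in>simple D. zscale (d \<beta>) \<beta>)" "\<beta> \<in> simple D"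
  shows "c \<beta> = d \<beta>"
proof -
  have "(\<Sum>\<beta>\<in>simple D. zscale (c \<beta> - d \<beta>) \<beta>) = 0"
    using assms(1) by (simp add: zscale.scale_left_diff_distrib sum_subtractf)
  with base have "\<forall>\<beta>\<in>simple D. c \<beta> - d \<beta> = 0"
    unfolding is_base_def by (elim conjE allE[of _ "\<lambda>\<beta>. c \<beta> - d \<beta>"]) blast
  with assms(2) show ?thesis by simp
qed

lemma simple_coords_single:
  assumes "\<beta> \<in> simple D"
  shows "(\<Sum>\<gamma>\<in>simple D. zscale (if \<gamma> = \<beta> then n else 0) \<gamma>) = zscale n \<beta>"
proof -
  have "(\<Sum>\<gamma>\<in>simple D. zscale (if \<gamma> = \<beta> then n else 0) \<gamma>) =
      (\<Sum>\<gamma>\<in>simple D. if \<gamma> = \<beta> then zscale n \<gamma> else 0)"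
    by (rule sum.cong) auto
  then show ?thesis
    using assms by simp
qed

lemma pos_simple: "\<beta> \<in> simple D \<Longrightarrow> pos \<beta>"
  using simple_coords_single[of \<beta> 1]
  by (auto simp: pos_def intro!: exI[of _ "\<lambda>\<gamma>. if \<gamma> = \<beta> then 1 else 0"])

lemma pos_zero: "pos 0"
  by (auto simp: pos_def intro!: exI[of _ "\<lambda>_. 0"])

lemma pos_add: "pos x \<Longrightarrow> pos y \<Longrightarrow> pos (x + y)"
proof -
  assume "pos x" "pos y"
  then obtain c d where
    "\<forall>\<beta>\<in>simple D. 0 \<le> c \<beta>" "x = (\<Sum>\<beta>\<in>simple D. zscale (c \<beta>) \<beta>)"
    "\<forall>\<beta>\<in>simple D. 0 \<le> d \<beta>" "y = (\<Sum>\<beta>\<in>simple D. zscale (d \<beta>) \<beta>)"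
    unfolding pos_def by blast
  then show ?thesis
    unfolding pos_def
    by (intro exI[of _ "\<lambda>\<beta>. c \<beta> + d \<beta>"]) (simp add: zscale_add sum.distrib)
qed

lemma pos_zscale: "0 \<le> n \<Longrightarrow> pos x \<Longrightarrow> pos (zscale n x)"
  by (induction n rule: int_ge_induct) (simp_all add: pos_zero zscale_add pos_add)

lemma pos_sum: "(\<And>i. i \<in> A \<Longrightarrow> pos (f i)) \<Longrightarrow> pos (\<Sum>i\<in>A. f i)"
  by (induction A rule: infinite_finite_induct) (simp_all add: pos_zero pos_add)

lemma pos_antisym:
  assumes "pos x" "pos (- x)"
  shows "x = 0"
proof -
  from assms obtain c d where c: "\<forall>\<beta>\<in>simple D. 0 \<le> c \<beta>" "x = (\<Sum>\<beta>\<in>simple D. zscale (c \<beta>) \<beta>)"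
    and d: "\<forall>\<beta>\<in>simple D. 0 \<le> d \<beta>" "- x = (\<Sum>\<beta>\<in>simple D. zscale (d \<beta>) \<beta>)"
    unfolding pos_def by blast
  have "(\<Sum>\<beta>\<in>simple D. zscale (c \<beta> + d \<beta>) \<beta>) = (\<Sum>\<beta>\<in>simple D. zscale ((\<lambda>_. 0) \<beta>) \<beta>)"
    using c(2) d(2) by (simp add: zscale_add sum.distrib flip: c(2) d(2))
  then have "c \<beta> + d \<beta> = 0" if "\<beta> \<in> simple D" for \<beta>
    using that by (rule simple_coords_unique)
  then have "c \<beta> = 0" if "\<beta> \<in> simple D" for \<beta>
    using that c(1) d(1) by fastforce
  then show ?thesis
    using c(2) by simp
qed

text \<open>Both signs are impossible because 0 is not a root; one of them occurs by the sign
  condition on a base.\<close>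

lemma root_pos_iff: "\<alpha> \<in> roots D \<Longrightarrow> pos (- \<alpha>) \<longleftrightarrow> \<not> pos \<alpha>"
proof
  assume \<alpha>: "\<alpha> \<in> roots D"
  show "\<not> pos \<alpha>" if "pos (- \<alpha>)"
    using pos_antisym[OF _ that] \<alpha> root_nonzero by auto
  obtain c where c: "\<alpha> = (\<Sum>\<beta>\<in>simple D. zscale (c \<beta>) \<beta>)"
    "(\<forall>\<beta>\<in>simple D. c \<beta> \<ge> 0) \<or> (\<forall>\<beta>\<in>simple D. c \<beta> \<le> 0)"
    using base \<alpha> unfolding is_base_def by blast
  show "pos (- \<alpha>)" if "\<not> pos \<alpha>"
    using that c unfolding pos_def
    by (auto simp: sum_negf intro!: exI[of _ "\<lambda>\<beta>. - c \<beta>"])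
qed

lemma reflection_coords:
  assumes "\<beta> \<in> simple D" "\<alpha> = (\<Sum>\<gamma>\<in>simple D. zscale (c \<gamma>) \<gamma>)"
  shows "\<s> \<beta> \<alpha> = (\<Sum>\<gamma>\<in>simple D. zscale (c \<gamma> - (if \<gamma> = \<beta> then coroot D \<beta> \<alpha> else 0)) \<gamma>)"
  by (simp add: reflection_def zscale.scale_left_diff_distrib sum_subtractf
      simple_coords_single[OF assms(1)] flip: assms(2))

text \<open>The reflection changes only the \<beta>-coordinate. If the image were negative, all
  other coordinates of \<alpha> would vanish, so \<alpha> would be a positive multiple of \<beta>,
  hence \<beta> itself as the root system is reduced.\<close>

lemma simple_reflection_pos:
  assumes \<beta>: "\<beta> \<in> simple D" and \<alpha>: "\<alpha> \<in> roots D" "pos \<alpha>" "\<alpha> \<noteq> \<beta>"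
  shows "pos (\<s> \<beta> \<alpha>)"
proof (rule ccontr)
  assume "\<not> pos (\<s> \<beta> \<alpha>)"
  then have "pos (- \<s> \<beta> \<alpha>)"
    using \<alpha>(1) \<beta> by (simp add: root_pos_iff reflection_root simple_root)
  then obtain d where d: "\<forall>\<gamma>\<in>simple D. 0 \<le> d \<gamma>" "- \<s> \<beta> \<alpha> = (\<Sum>\<gamma>\<in>simple D. zscale (d \<gamma>) \<gamma>)"
    unfolding pos_def by blast
  obtain c where c: "\<forall>\<gamma>\<in>simple D. 0 \<le> c \<gamma>" "\<alpha> = (\<Sum>\<gamma>\<in>simple D. zscale (c \<gamma>) \<gamma>)"
    using \<alpha>(2) unfolding pos_def by blast
  have "\<s> \<beta> \<alpha> = (\<Sum>\<gamma>\<in>simple D. zscale (- d \<gamma>) \<gamma>)"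
    by (simp add: sum_negf flip: d(2))
  then have cd: "c \<gamma> - (if \<gamma> = \<beta> then coroot D \<beta> \<alpha> else 0) = - d \<gamma>" if "\<gamma> \<in> simple D" for \<gamma>
    using that unfolding reflection_coords[OF \<beta> c(2)] by (rule simple_coords_unique)
  have "c \<gamma> = (if \<gamma> = \<beta> then c \<beta> else 0)" if "\<gamma> \<in> simple D" for \<gamma>
    using cd[OF that] c(1) d(1) that by fastforce
  then have "\<alpha> = (\<Sum>\<gamma>\<in>simple D. zscale (if \<gamma> = \<beta> then c \<beta> else 0) \<gamma>)"
    unfolding c(2) by (intro sum.cong) metis+
  then have "\<alpha> = zscale (c \<beta>) \<beta>"
    by (simp add: simple_coords_single[OF \<beta>])
  moreover from this have "c \<beta> = 1 \<or> c \<beta> = - 1"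
    using multiple_root \<alpha>(1) \<beta> simple_root by metis
  ultimately show False
    using c(1) \<beta> \<alpha>(3) by auto
qed

section \<open>Generation by simple reflections\<close>

text \<open>
  The invariant form \<open>\<Sum>\<^sub>\<gamma> \<langle>x, \<gamma>\<^sup>\<or>\<rangle> \<langle>y, \<gamma>\<^sup>\<or>\<rangle>\<close> is positive on roots and proportional to \<open>\<beta>\<^sup>\<or>\<close> in
  \<open>y\<close> for \<open>x = \<beta>\<close>; hence every positive root pairs positively with some simple coroot, and
  reflecting in it lowers the height.
\<close>

definition form :: "'l \<Rightarrow> 'l \<Rightarrow> int"
  where "form x y = (\<Sum>\<gamma>\<in>roots D. coroot D \<gamma> x * coroot D \<gamma> y)"

text \<open>The reflection permutes the roots over which the form sums, and
  \<open>coroot_reflection\<close> matches the terms.\<close>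

lemma form_reflection:
  assumes "\<alpha> \<in> roots D"
  shows "form (\<s> \<alpha> x) (\<s> \<alpha> y) = form x y"
  unfolding form_def
  using assms coroot_reflection[OF assms, of _ "\<s> \<alpha> _"]
  by (intro sum.reindex_bij_witness[of _ "\<s> \<alpha>" "\<s> \<alpha>"])
    (simp_all add: reflection_root reflection_involution)

text \<open>All terms are squares, and the one at \<alpha> is 4.\<close>

lemma form_root_pos: "\<alpha> \<in> roots D \<Longrightarrow> 0 < form \<alpha> \<alpha>"
  unfolding form_def by (rule sum_pos2[of _ \<alpha>]) auto

lemma form_commute: "form x y = form y x"
  by (simp add: form_def mult.commute)

lemma additive_form: "additive (form x)"
  by (simp add: additive_def form_def coroot_linear distrib_left sum.distrib)

text \<open>Invariance under \<open>\<s> \<beta>\<close>, which negates \<beta>, gives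
  \<open>form \<beta> x = - form \<beta> (\<s> \<beta> x)\<close>; expanding the reflection leaves
  the multiple of the coroot.\<close>

lemma form_coroot:
  assumes "\<beta> \<in> roots D"
  shows "2 * form \<beta> x = coroot D \<beta> x * form \<beta> \<beta>"
proof -
  note form_linear = additive.diff[OF additive_form] additive.minus[OF additive_form]
    additive_zscale[OF additive_form] zscale_int
  have "form \<beta> x = form (\<s> \<beta> \<beta>) (\<s> \<beta> x)"
    using assms by (simp add: form_reflection)
  also have "\<dots> = - form (\<s> \<beta> x) \<beta>"
    using assms by (simp add: reflection_self form_linear form_commute[of "- \<beta>"])
  also have "\<dots> = - form \<beta> (\<s> \<beta> x)"
    by (simp add: form_commute)
  also have "\<dots> = coroot D \<beta> x * form \<beta> \<beta> - form \<beta> x"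
    by (simp add: reflection_def form_linear)
  finally show ?thesis by simp
qed

text \<open>If no simple coroot were positive on \<alpha>, then
  \<open>form \<beta> \<alpha> \<le> 0\<close> for all simple \<beta>, and expanding \<alpha> in
  simple roots would give \<open>form \<alpha> \<alpha> \<le> 0\<close>.\<close>

lemma exists_simple_coroot_pos:
  assumes \<alpha>: "\<alpha> \<in> roots D" "pos \<alpha>"
  obtains \<beta> where "\<beta> \<in> simple D" "0 < coroot D \<beta> \<alpha>"
proof (rule ccontr)
  assume "\<not> thesis"
  with that have neg: "coroot D \<beta> \<alpha> \<le> 0" if "\<beta> \<in> simple D" for \<beta>
    using \<open>\<beta> \<in> simple D\<close> not_le by blast
  obtain c where c: "\<forall>\<gamma>\<in>simple D. 0 \<le> c \<gamma>" "\<alpha> = (\<Sum>\<gamma>\<in>simple D. zscale (c \<gamma>) \<gamma>)"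
    using \<alpha>(2) unfolding pos_def by blast
  have "form \<beta> \<alpha> \<le> 0" if "\<beta> \<in> simple D" for \<beta>
    using form_coroot[OF simple_root[OF that], of \<alpha>] neg[OF that]
      mult_nonpos_nonneg[OF neg[OF that] less_imp_le[OF form_root_pos[OF simple_root[OF that]]]]
    by linarith
  then have "(\<Sum>\<beta>\<in>simple D. c \<beta> * form \<alpha> \<beta>) \<le> 0"
    using c(1) by (intro sum_nonpos) (simp add: form_commute mult_nonneg_nonpos)
  moreover have "form \<alpha> \<alpha> = (\<Sum>\<beta>\<in>simple D. c \<beta> * form \<alpha> \<beta>)"
    by (subst (2) c(2)) (simp add: additive.sum[OF additive_form] additive_zscale[OF additive_form]
        zscale_int)
  ultimately show False
    using form_root_pos[OF \<alpha>(1)] by simp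
qed

lemma simple_weyl: "w \<in> refl_group D (simple D) \<Longrightarrow> w \<in> weyl D"
  using refl_group_mono simple_subset by blast

lemma reflection_weyl_eq:
  assumes "\<alpha> \<in> roots D" "\<beta> \<in> roots D"
  shows "\<s> (\<s> \<beta> \<alpha>) = \<s> \<beta> \<circ> \<s> \<alpha> \<circ> \<s> \<beta>"
proof
  fix x
  show "\<s> (\<s> \<beta> \<alpha>) x = (\<s> \<beta> \<circ> \<s> \<alpha> \<circ> \<s> \<beta>) x"
    using fun_cong[OF reflection_weyl[OF reflection_in_refl_group assms(1)], OF assms(2), of "\<s> \<beta> x"]
      assms by (simp add: reflection_involution)
qed

text \<open>Induction on the height, which is why coordinates appear instead of \<open>pos\<close>.
  Unless \<alpha> is simple, \<open>\<s> \<alpha>\<close> is conjugate under a simple reflection to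
  the reflection in a lower positive root.\<close>

lemma pos_root_reflection_simple:
  assumes "\<alpha> \<in> roots D" "\<forall>\<beta>\<in>simple D. 0 \<le> c \<beta>" "\<alpha> = (\<Sum>\<beta>\<in>simple D. zscale (c \<beta>) \<beta>)"
  shows "\<s> \<alpha> \<in> refl_group D (simple D)"
  using assms
proof (induction "nat (\<Sum>\<beta>\<in>simple D. c \<beta>)" arbitrary: \<alpha> c rule: less_induct)
  case less
  have "pos \<alpha>"
    using less.prems unfolding pos_def by blast
  with less.prems obtain \<beta> where \<beta>: "\<beta> \<in> simple D" "0 < coroot D \<beta> \<alpha>"
    using exists_simple_coroot_pos by blast
  show ?case
  proof (cases "\<alpha> = \<beta>")
    case True
    then show ?thesis
      using \<beta> by (simp add: reflection_in_refl_group)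
  next
    case False
    define c' where "c' \<gamma> = c \<gamma> - (if \<gamma> = \<beta> then coroot D \<beta> \<alpha> else 0)" for \<gamma>
    have c': "\<s> \<beta> \<alpha> = (\<Sum>\<gamma>\<in>simple D. zscale (c' \<gamma>) \<gamma>)"
      unfolding c'_def by (rule reflection_coords[OF \<beta>(1) less.prems(3)])
    have "pos (\<s> \<beta> \<alpha>)"
      using \<beta>(1) less.prems(1) \<open>pos \<alpha>\<close> False by (rule simple_reflection_pos)
    then obtain d where d: "\<forall>\<gamma>\<in>simple D. 0 \<le> d \<gamma>" "\<s> \<beta> \<alpha> = (\<Sum>\<gamma>\<in>simple D. zscale (d \<gamma>) \<gamma>)"
      unfolding pos_def by blast
    \<comment> \<open>The coordinates \<open>d\<close> obtained from \<open>pos\<close> are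
      nonnegative, and \<open>c'\<close> has the computed height; uniqueness identifies the two
      families.\<close>
    have "c' \<gamma> = d \<gamma>" if "\<gamma> \<in> simple D" for \<gamma>
      using trans[OF c'[symmetric] d(2)] that by (rule simple_coords_unique)
    with d(1) have nonneg: "\<forall>\<gamma>\<in>simple D. 0 \<le> c' \<gamma>"
      by simp
    have "(\<Sum>\<gamma>\<in>simple D. c' \<gamma>) < (\<Sum>\<gamma>\<in>simple D. c \<gamma>)"
      using \<beta> by (simp add: c'_def sum_subtractf)
    \<comment> \<open>With this bound the strict inequality of heights survives the conversion by
      \<open>nat\<close>.\<close>
    moreover have "0 \<le> (\<Sum>\<gamma>\<in>simple D. c' \<gamma>)"
      using nonneg by (simp add: sum_nonneg)
    ultimately have "\<s> (\<s> \<beta> \<alpha>) \<in> refl_group D (simple D)"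
      using less.prems(1) \<beta>(1) by (intro less.hyps[OF _ _ nonneg c'])
        (auto intro: reflection_root simple_root)
    moreover have "\<s> \<alpha> = \<s> \<beta> \<circ> \<s> (\<s> \<beta> \<alpha>) \<circ> \<s> \<beta>"
      using reflection_weyl_eq[of "\<s> \<beta> \<alpha>" \<beta>] less.prems(1) \<beta>(1)
      by (simp add: reflection_root simple_root reflection_involution)
    ultimately show ?thesis
      using \<beta>(1) by (simp add: refl_group_comp reflection_in_refl_group)
  qed
qed

text \<open>For each root, it or its negative is positive, and both define the same reflection, so
  the height induction reaches every generator.\<close>

lemma weyl_eq_simple: "weyl D = refl_group D (simple D)"
proof
  have pos_refl: "\<s> \<alpha> \<in> refl_group D (simple D)" if "\<alpha> \<in> roots D" "pos \<alpha>" for \<alpha>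
    using that pos_root_reflection_simple unfolding pos_def by blast
  have refl: "\<s> \<alpha> \<in> refl_group D (simple D)" if "\<alpha> \<in> roots D" for \<alpha>
  proof (cases "pos \<alpha>")
    case True
    with that show ?thesis
      by (rule pos_refl)
  next
    case False
    with that have "\<s> (- \<alpha>) \<in> refl_group D (simple D)"
      by (intro pos_refl uminus_root) (simp_all add: root_pos_iff)
    with that show ?thesis
      by (simp add: reflection_uminus_root)
  qed
  show "weyl D \<subseteq> refl_group D (simple D)"
  proof
    fix w assume "w \<in> weyl D"
    then show "w \<in> refl_group D (simple D)"
      by induction (blast intro: refl_group.id refl_group_comp refl)+
  qed
  show "refl_group D (simple D) \<subseteq> weyl D"
    using simple_weyl by blast
qed

section \<open>Words and minimal coset representatives\<close>

definition word :: "'l list \<Rightarrow> 'l \<Rightarrow> 'l"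
  where "word \<beta>s = foldr (\<lambda>\<beta> u. \<s> \<beta> \<circ> u) \<beta>s id"

lemma word_simps [simp]: "word [] = id" "word (\<beta> # \<beta>s) = \<s> \<beta> \<circ> word \<beta>s"
  by (simp_all add: word_def)

lemma word_append: "word (\<beta>s @ \<gamma>s) = word \<beta>s \<circ> word \<gamma>s"
  by (induction \<beta>s) (simp_all add: comp_assoc)

lemma word_in_refl_group: "set \<beta>s \<subseteq> A \<Longrightarrow> word \<beta>s \<in> refl_group D A"
  by (induction \<beta>s) (auto intro: refl_group.intros)

lemma refl_group_word:
  assumes "w \<in> refl_group D A"
  obtains \<beta>s where "set \<beta>s \<subseteq> A" "w = word \<beta>s"
proof -
  have "\<exists>\<beta>s. set \<beta>s \<subseteq> A \<and> w = word \<beta>s"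
    using assms
  proof induction
    case id
    show ?case by (intro exI[of _ "[]"]) simp
  next
    case (step \<alpha> w)
    then obtain \<beta>s where "set \<beta>s \<subseteq> A" "w = word \<beta>s"
      by blast
    with step show ?case
      by (intro exI[of _ "\<alpha> # \<beta>s"]) simp
  qed
  then show thesis
    using that by blast
qed

lemma weyl_length_le: "set \<beta>s \<subseteq> simple D \<Longrightarrow> weyl_length D (word \<beta>s) \<le> length \<beta>s"
  unfolding weyl_length_def word_def by (rule Least_le) blast

lemma reduced_word:
  assumes "w \<in> weyl D"
  obtains \<beta>s where "set \<beta>s \<subseteq> simple D" "w = word \<beta>s" "length \<beta>s = weyl_length D w"
proof -
  obtain \<gamma>s where "set \<gamma>s \<subseteq> simple D" "w = word \<gamma>s"
    using assms by (auto simp: weyl_eq_simple elim: refl_group_word)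
  then have "\<exists>\<beta>s. length \<beta>s = length \<gamma>s \<and> set \<beta>s \<subseteq> simple D \<and> w = word \<beta>s"
    by blast
  from LeastI[of "\<lambda>n. \<exists>\<beta>s. length \<beta>s = n \<and> set \<beta>s \<subseteq> simple D \<and> w = word \<beta>s", OF this]
  show thesis
    using that unfolding weyl_length_def word_def by blast
qed

text \<open>Applying the word to \<alpha> from the right, some letter \<beta> first makes the image
  negative. Just before, the image must be \<beta>, the only positive root that
  \<open>\<s> \<beta>\<close> makes negative; then \<open>\<s> \<alpha>\<close> can be moved through
  the letters on its right to cancel this \<beta>.\<close>

lemma exchange:
  assumes "set \<beta>s \<subseteq> simple D" "\<alpha> \<in> simple D" "\<not> pos (word \<beta>s \<alpha>)"
  shows "\<exists>\<gamma>s. set \<gamma>s \<subseteq> set \<beta>s \<and> length \<beta>s = Suc (length \<gamma>s) \<and> word \<beta>s \<circ> \<s> \<alpha> = word \<gamma>s"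
  using assms
proof (induction \<beta>s)
  case Nil
  then show ?case
    by (simp add: pos_simple)
next
  case (Cons \<beta> \<beta>s)
  have w: "word \<beta>s \<in> weyl D"
    using Cons.prems(1) by (intro simple_weyl word_in_refl_group) simp
  show ?case
  proof (cases "pos (word \<beta>s \<alpha>)")
    case False
    moreover have "set \<beta>s \<subseteq> simple D"
      using Cons.prems(1) by simp
    ultimately obtain \<gamma>s where "set \<gamma>s \<subseteq> set \<beta>s" "length \<beta>s = Suc (length \<gamma>s)"
      "word \<beta>s \<circ> \<s> \<alpha> = word \<gamma>s"
      using Cons.IH Cons.prems(2) by blast
    then show ?thesis
      by (intro exI[of _ "\<beta> # \<gamma>s"]) (auto simp: fun_eq_iff)
  next
    case True
    have "word \<beta>s \<alpha> = \<beta>"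
      using simple_reflection_pos[of \<beta> "word \<beta>s \<alpha>"] Cons.prems True
      by (auto simp: weyl_root[OF w] simple_root)
    then have "\<s> \<beta> \<circ> word \<beta>s = word \<beta>s \<circ> \<s> \<alpha>"
      using reflection_weyl[OF w simple_root[OF Cons.prems(2)]] by simp
    then have "word (\<beta> # \<beta>s) \<circ> \<s> \<alpha> = word \<beta>s"
      using Cons.prems(2) by (simp add: fun_eq_iff reflection_involution simple_root)
    then show ?thesis
      by (intro exI[of _ \<beta>s]) (auto simp: fun_eq_iff)
  qed
qed

section \<open>Positivity and uniqueness of minimal representatives\<close>

lemma min_reps_pos:
  assumes "I \<subseteq> simple D" "w \<in> min_reps D I" "\<alpha> \<in> I"
  shows "pos (w \<alpha>)"
proof (rule ccontr)
  assume neg: "\<not> pos (w \<alpha>)"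
  obtain \<beta>s where \<beta>s: "set \<beta>s \<subseteq> simple D" "w = word \<beta>s" "length \<beta>s = weyl_length D w"
    using assms(2) reduced_word unfolding min_reps_def by blast
  obtain \<gamma>s where \<gamma>s: "set \<gamma>s \<subseteq> set \<beta>s" "length \<beta>s = Suc (length \<gamma>s)" "w \<circ> \<s> \<alpha> = word \<gamma>s"
    using exchange[of \<beta>s \<alpha>] \<beta>s neg assms by blast
  \<comment> \<open>The exchanged word has one letter less than a reduced word of \<open>w\<close>,
    so this element of the same coset is shorter than the minimal one.\<close>
  have "weyl_length D (w \<circ> \<s> \<alpha>) < weyl_length D w"
    using weyl_length_le[OF order_trans[OF \<gamma>s(1) \<beta>s(1)]] \<beta>s(3) \<gamma>s(2,3) by simp
  moreover have "w \<circ> \<s> \<alpha> \<in> par_coset D I w"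
    using assms(3) by (auto simp: par_coset_def reflection_in_refl_group)
  ultimately show False
    using assms(2) unfolding min_reps_def by fastforce
qed

text \<open>The root \<alpha> is the last letter of a shortest word for \<open>u\<close> in the
  letters \<open>I\<close>: if its image were positive, exchange in the preceding letters would
  produce a still shorter word.\<close>

lemma refl_group_neg_simple:
  assumes "I \<subseteq> simple D" "u \<in> refl_group D I" "u \<noteq> id"
  obtains \<alpha> where "\<alpha> \<in> I" "\<not> pos (u \<alpha>)"
proof -
  \<comment> \<open>Length is counted with letters from \<open>I\<close> only, whereas
    \<open>weyl_length\<close> admits all simple reflections; exchange keeps to the given
    letters.\<close>
  define P where "P n \<longleftrightarrow> (\<exists>\<beta>s. length \<beta>s = n \<and> set \<beta>s \<subseteq> I \<and> u = word \<beta>s)" for n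
  have "\<exists>n. P n"
    using assms(2) by (auto simp: P_def elim: refl_group_word)
  then obtain n where n: "P n" "\<And>m. m < n \<Longrightarrow> \<not> P m"
    using exists_least_iff[of P] by blast
  then obtain \<beta>s where \<beta>s: "length \<beta>s = n" "set \<beta>s \<subseteq> I" "u = word \<beta>s"
    by (auto simp: P_def)
  with assms(3) obtain \<gamma>s \<alpha> where \<gamma>s: "\<beta>s = \<gamma>s @ [\<alpha>]"
    by (cases \<beta>s rule: rev_cases) auto
  have \<alpha>: "\<alpha> \<in> I" "\<alpha> \<in> simple D"
    using \<beta>s(2) assms(1) by (auto simp: \<gamma>s)
  have u: "u = word \<gamma>s \<circ> \<s> \<alpha>"
    using \<beta>s(3) by (simp add: \<gamma>s word_append)
  have w: "word \<gamma>s \<in> weyl D"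
    using \<beta>s(2) assms(1) by (intro simple_weyl word_in_refl_group) (auto simp: \<gamma>s)
  have "\<not> pos (u \<alpha>)"
  proof
    assume "pos (u \<alpha>)"
    then have "pos (- word \<gamma>s \<alpha>)"
      using \<alpha>(2) by (simp add: u reflection_self simple_root additive.minus[OF additive_weyl[OF w]])
    then have "\<not> pos (word \<gamma>s \<alpha>)"
      using root_pos_iff weyl_root[OF w simple_root[OF \<alpha>(2)]] by blast
    then obtain \<delta>s where "set \<delta>s \<subseteq> set \<gamma>s" "length \<gamma>s = Suc (length \<delta>s)" "u = word \<delta>s"
      using exchange[of \<gamma>s \<alpha>] \<beta>s(2) assms(1) \<alpha>(2) by (auto simp: \<gamma>s u)
    moreover from this have "P (length \<delta>s)"
      using \<beta>s(2) by (auto simp: P_def \<gamma>s)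
    ultimately show False
      using n(2)[of "length \<delta>s"] \<beta>s(1) by (simp add: \<gamma>s)
  qed
  with \<alpha>(1) that show thesis by blast
qed

text \<open>A reflection in a root of \<open>I\<close> alters only a coordinate indexed by
  \<open>I\<close>, so the coordinates outside \<open>I\<close> stay 0.\<close>

lemma refl_group_coords:
  assumes "I \<subseteq> simple D" "u \<in> refl_group D I" "\<alpha> \<in> I"
  shows "\<exists>c. (\<forall>\<gamma>. \<gamma> \<notin> I \<longrightarrow> c \<gamma> = 0) \<and> u \<alpha> = (\<Sum>\<gamma>\<in>simple D. zscale (c \<gamma>) \<gamma>)"
  using assms(2)
proof induction
  case id
  show ?case
    using assms(1,3) simple_coords_single[of \<alpha> 1]
    by (intro exI[of _ "\<lambda>\<gamma>. if \<gamma> = \<alpha> then 1 else 0"]) auto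
next
  case (step \<beta> u)
  then obtain c where "\<forall>\<gamma>. \<gamma> \<notin> I \<longrightarrow> c \<gamma> = 0" "u \<alpha> = (\<Sum>\<gamma>\<in>simple D. zscale (c \<gamma>) \<gamma>)"
    by blast
  with step.hyps(1) assms(1) show ?case
    using reflection_coords[of \<beta> "u \<alpha>" c]
    by (intro exI[of _ "\<lambda>\<gamma>. c \<gamma> - (if \<gamma> = \<beta> then coroot D \<beta> (u \<alpha>) else 0)"]) auto
qed

lemma min_reps_unique:
  assumes I: "I \<subseteq> simple D" and w: "w \<in> min_reps D I"
    and u: "u \<in> refl_group D I" and wu: "w \<circ> u \<in> min_reps D I"
  shows "u = id"
proof (rule ccontr)
  assume "u \<noteq> id"
  then obtain \<alpha> where \<alpha>: "\<alpha> \<in> I" "\<not> pos (u \<alpha>)"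
    using refl_group_neg_simple I u by blast
  have uW: "u \<in> weyl D" and wW: "w \<in> weyl D"
    using refl_group_mono[OF order_trans[OF I simple_subset] u] w by (auto simp: min_reps_def)
  have \<alpha>R: "\<alpha> \<in> roots D"
    using \<alpha>(1) I simple_root by blast
  obtain c where c: "\<forall>\<gamma>. \<gamma> \<notin> I \<longrightarrow> c \<gamma> = 0" "u \<alpha> = (\<Sum>\<gamma>\<in>simple D. zscale (c \<gamma>) \<gamma>)"
    using refl_group_coords[OF I u \<alpha>(1)] by blast
  have "pos (- u \<alpha>)"
    using \<alpha>(2) root_pos_iff[OF weyl_root[OF uW \<alpha>R]] by blast
  then obtain d where d: "\<forall>\<gamma>\<in>simple D. 0 \<le> d \<gamma>" "- u \<alpha> = (\<Sum>\<gamma>\<in>simple D. zscale (d \<gamma>) \<gamma>)"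
    unfolding pos_def by blast
  \<comment> \<open>One expansion carries the sign, the other the support in \<open>I\<close>.
    Together they make \<open>- u \<alpha>\<close> a nonnegative combination of \<open>I\<close>,
    which \<open>w\<close> keeps positive.\<close>
  have "(\<Sum>\<gamma>\<in>simple D. zscale (d \<gamma>) \<gamma>) = (\<Sum>\<gamma>\<in>simple D. zscale (- c \<gamma>) \<gamma>)"
    by (simp add: sum_negf flip: c(2) d(2))
  then have dc: "d \<gamma> = - c \<gamma>" if "\<gamma> \<in> simple D" for \<gamma>
    using that by (rule simple_coords_unique)
  have "pos (\<Sum>\<gamma>\<in>simple D. zscale (d \<gamma>) (w \<gamma>))"
  proof (rule pos_sum)
    fix \<gamma> assume \<gamma>: "\<gamma> \<in> simple D"
    show "pos (zscale (d \<gamma>) (w \<gamma>))"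
    proof (cases "\<gamma> \<in> I")
      case True
      then show ?thesis
        using d(1) \<gamma> min_reps_pos[OF I w] by (intro pos_zscale) auto
    next
      case False
      then show ?thesis
        using c(1) dc[OF \<gamma>] by (simp add: pos_zero)
    qed
  qed
  also have "(\<Sum>\<gamma>\<in>simple D. zscale (d \<gamma>) (w \<gamma>)) = w (- u \<alpha>)"
    by (simp add: d(2) weyl_linear[OF wW])
  also have "\<dots> = - (w \<circ> u) \<alpha>"
    by (simp add: weyl_linear[OF wW])
  finally have "\<not> pos ((w \<circ> u) \<alpha>)"
    using root_pos_iff weyl_root[OF wW weyl_root[OF uW \<alpha>R]] by simp
  then show False
    using min_reps_pos[OF I wu \<alpha>(1)] by blast
qed

section \<open>Parabolic cosets and the choice of their representatives\<close>

lemma par_coset_self: "w \<in> par_coset D I w"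
  unfolding par_coset_def by (rule image_eqI[of _ _ id]) (auto intro: refl_group.id)

lemma par_coset_eq:
  assumes "I \<subseteq> roots D" "v \<in> par_coset D I w"
  shows "par_coset D I v = par_coset D I w"
proof -
  obtain u where u: "u \<in> refl_group D I" "v = w \<circ> u"
    using assms(2) unfolding par_coset_def by blast
  obtain u' where u': "u' \<in> refl_group D I" "u' \<circ> u = id" "u \<circ> u' = id"
    using refl_group_inverse u(1) assms(1) by blast
  have "par_coset D I v \<subseteq> par_coset D I w"
    using u by (auto simp: par_coset_def comp_assoc intro: refl_group_comp)
  moreover have "w \<circ> x \<in> par_coset D I v" if "x \<in> refl_group D I" for x
  proof -
    have "w \<circ> x = v \<circ> (u' \<circ> x)"
      using u'(3) by (simp add: u(2) fun_eq_iff)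
    then show ?thesis
      using that u'(1) refl_group_comp by (auto simp: par_coset_def)
  qed
  then have "par_coset D I w \<subseteq> par_coset D I v"
    by (auto simp: par_coset_def[of D I w])
  ultimately show ?thesis by blast
qed

lemma min_reps_eqI:
  assumes "I \<subseteq> simple D" "v \<in> min_reps D I" "w \<in> min_reps D I" "v \<in> par_coset D I w"
  shows "v = w"
  using assms min_reps_unique[of I w] unfolding par_coset_def by fastforce

lemma ex_min_rep:
  assumes "I \<subseteq> simple D" "w \<in> weyl D"
  shows "\<exists>v. v \<in> min_reps D I \<and> v \<in> par_coset D I w"
proof -
  obtain v where v: "v \<in> par_coset D I w"
    "\<And>v'. v' \<in> par_coset D I w \<Longrightarrow> weyl_length D v \<le> weyl_length D v'"
    using ex_has_least_nat[of "\<lambda>v. v \<in> par_coset D I w" w "weyl_length D"] par_coset_self by blast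
  have I: "I \<subseteq> roots D"
    using assms(1) simple_root by blast
  have "v \<in> weyl D"
    using v(1) assms(2) refl_group_mono[OF I] by (auto simp: par_coset_def intro: refl_group_comp)
  then have "v \<in> min_reps D I"
    using v par_coset_eq[OF I v(1)] by (simp add: min_reps_def)
  with v(1) show ?thesis by blast
qed

lemma min_rep_eqI:
  assumes "I \<subseteq> simple D" "v \<in> min_reps D I" "v \<in> par_coset D I w"
  shows "min_rep D I w = v"
  unfolding min_rep_def
proof (rule the_equality)
  fix v' assume "v' \<in> min_reps D I \<and> v' \<in> par_coset D I w"
  moreover have "par_coset D I v = par_coset D I w"
    using assms simple_root by (intro par_coset_eq) auto
  ultimately show "v' = v"
    using assms by (intro min_reps_eqI) auto
qed (use assms in simp)

lemma min_rep_in_min_reps: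
  assumes "I \<subseteq> simple D" "w \<in> weyl D"
  shows "min_rep D I w \<in> min_reps D I"
  using ex_min_rep[OF assms] min_rep_eqI[OF assms(1)] by auto

lemma finite_min_reps: "finite (min_reps D I)"
  by (rule finite_subset[OF _ finite_weyl]) (auto simp: min_reps_def)

lemma id_in_min_reps: "id \<in> min_reps D I"
  using weyl_length_le[of "[]"] by (simp add: min_reps_def refl_group.id)

lemma min_reps_coset_eq_iff:
  assumes "I \<subseteq> simple D" "v \<in> min_reps D I" "w \<in> min_reps D I"
  shows "par_coset D I v = par_coset D I w \<longleftrightarrow> v = w"
  using min_reps_eqI[OF assms] par_coset_self[of v I] by auto

end

section \<open>Renaming of variables\<close>

lemma coeff_mps_rename:
  "bij \<sigma> \<Longrightarrow> coeff (mps_rename \<sigma> f) m = coeff f (Poly_Mapping.map_key \<sigma> m)"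
  by (simp add: mps_rename.rep_eq)

context
  fixes \<sigma> :: "'a \<Rightarrow> 'a"
  assumes \<sigma>: "bij \<sigma>"
begin

lemma map_key_inv:
  "Poly_Mapping.map_key (inv \<sigma>) (Poly_Mapping.map_key \<sigma> m) = m"
  "Poly_Mapping.map_key \<sigma> (Poly_Mapping.map_key (inv \<sigma>) m) = m"
proof -
  have inj: "inj \<sigma>" "inj (inv \<sigma>)"
    using \<sigma> bij_imp_bij_inv by (auto intro: bij_is_inj)
  show "Poly_Mapping.map_key (inv \<sigma>) (Poly_Mapping.map_key \<sigma> m) = m"
    and "Poly_Mapping.map_key \<sigma> (Poly_Mapping.map_key (inv \<sigma>) m) = m"
    using inj \<sigma> by (auto intro!: poly_mapping_eqI
        simp: map_key.rep_eq bij_is_surj surj_f_inv_f inv_f_f)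
qed

lemma mdeg_map_key: "mdeg (Poly_Mapping.map_key \<sigma> m) = mdeg m"
proof -
  have inj: "inj \<sigma>" and surj: "surj \<sigma>"
    using \<sigma> by (auto simp: bij_def)
  have "Poly_Mapping.keys m = \<sigma> ` Poly_Mapping.keys (Poly_Mapping.map_key \<sigma> m)"
    using surj by (auto simp: keys_map_key[OF inj])
  then show ?thesis
    by (simp add: mdeg_def sum.reindex[OF inj_on_subset[OF inj subset_UNIV]]
        map_key.rep_eq[OF inj])
qed

lemma mps_rename_add: "mps_rename \<sigma> (f + g) = mps_rename \<sigma> f + mps_rename \<sigma> g"
  by (rule mps_eqI) (simp add: coeff_mps_rename[OF \<sigma>] plus_mps.rep_eq)

lemma additive_mps_rename: "additive (mps_rename \<sigma>)"
  by (simp add: additive_def mps_rename_add)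

lemma mps_rename_mult: "mps_rename \<sigma> (f * g) = mps_rename \<sigma> f * mps_rename \<sigma> g"
proof (rule mps_eqI)
  fix m
  have inj: "inj \<sigma>" "inj (inv \<sigma>)"
    using \<sigma> bij_imp_bij_inv by (auto intro: bij_is_inj)
  show "coeff (mps_rename \<sigma> (f * g)) m = coeff (mps_rename \<sigma> f * mps_rename \<sigma> g) m"
    unfolding times_mps.rep_eq coeff_mps_rename[OF \<sigma>]
    by (rule sum.reindex_bij_witness
        [of _ "map_prod (Poly_Mapping.map_key \<sigma>) (Poly_Mapping.map_key \<sigma>)"
          "map_prod (Poly_Mapping.map_key (inv \<sigma>)) (Poly_Mapping.map_key (inv \<sigma>))"])
      (auto simp: map_key_inv map_key_plus[OF inj(1)] map_key_plus[OF inj(2), symmetric])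
qed

lemma mps_rename_one: "mps_rename \<sigma> 1 = 1"
proof (rule mps_eqI)
  fix m :: "'a \<Rightarrow>\<^sub>0 nat"
  have "Poly_Mapping.map_key \<sigma> m = 0 \<longleftrightarrow> m = 0"
    using map_key_inv(1)[of m] bij_is_inj[OF \<sigma>] bij_is_inj[OF bij_imp_bij_inv[OF \<sigma>]] by force
  then show "coeff (mps_rename \<sigma> 1) m = coeff 1 m"
    by (simp add: coeff_mps_rename[OF \<sigma>] one_mps.rep_eq)
qed

lemma mps_rename_power: "mps_rename \<sigma> (f ^ n) = mps_rename \<sigma> f ^ n"
  by (induction n) (simp_all add: mps_rename_one mps_rename_mult)

lemma mps_rename_X: "mps_rename \<sigma> (X i) = X (\<sigma> i)"
proof (rule mps_eqI)
  fix m
  have "Poly_Mapping.map_key \<sigma> m = Poly_Mapping.single i 1 \<longleftrightarrow> m = Poly_Mapping.single (\<sigma> i) (1 :: nat)"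
    using map_key_inv(1)[of m] map_key_inv(1)[of "Poly_Mapping.single (\<sigma> i) 1"]
      map_key_single[OF bij_is_inj[OF \<sigma>], of i 1] by metis
  then show "coeff (mps_rename \<sigma> (X i)) m = coeff (X (\<sigma> i)) m"
    by (simp add: coeff_mps_rename[OF \<sigma>] X.rep_eq)
qed

text \<open>The coefficient formula is truncated at the degree of the monomial, which renaming
  preserves.\<close>

lemma mps_rename_fgl_subst:
  "mps_rename \<sigma> (fgl_subst F f g) = fgl_subst F (mps_rename \<sigma> f) (mps_rename \<sigma> g)"
  by (rule mps_eqI)
    (simp add: coeff_mps_rename[OF \<sigma>] coeff_fgl_subst mdeg_map_key
      flip: mps_rename_power mps_rename_mult)

text \<open>Sums in \<open>ideal_generated\<close> are indexed by the generators themselves, so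
  distinct generators have to stay distinct under renaming.\<close>

lemma inj_mps_rename: "inj (mps_rename \<sigma>)"
proof (rule injI, rule mps_eqI)
  fix f g :: "('a, 'b::comm_ring_1) mps" and m
  assume "mps_rename \<sigma> f = mps_rename \<sigma> g"
  then have "coeff (mps_rename \<sigma> f) (Poly_Mapping.map_key (inv \<sigma>) m) =
      coeff (mps_rename \<sigma> g) (Poly_Mapping.map_key (inv \<sigma>) m)"
    by simp
  then show "coeff f m = coeff g m"
    by (simp add: coeff_mps_rename[OF \<sigma>] map_key_inv)
qed

lemma mps_rename_ambient:
  assumes "f \<in> fg_ambient pol"
  shows "mps_rename \<sigma> f \<in> fg_ambient pol"
proof (cases pol)
  case True
  have "{m. coeff (mps_rename \<sigma> f) m \<noteq> 0} \<subseteq> Poly_Mapping.map_key (inv \<sigma>) ` {m. coeff f m \<noteq> 0}"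
  proof
    fix m assume "m \<in> {m. coeff (mps_rename \<sigma> f) m \<noteq> 0}"
    then show "m \<in> Poly_Mapping.map_key (inv \<sigma>) ` {m. coeff f m \<noteq> 0}"
      by (intro image_eqI[of _ _ "Poly_Mapping.map_key \<sigma> m"])
        (simp_all add: map_key_inv coeff_mps_rename[OF \<sigma>])
  qed
  with True assms show ?thesis
    by (auto simp: fg_ambient_def mps_polynomials_def intro: finite_subset)
qed (simp add: fg_ambient_def)

lemma mps_rename_ideal_generated:
  assumes "f \<in> ideal_generated (fg_ambient pol) K" "mps_rename \<sigma> ` K \<subseteq> K"
  shows "mps_rename \<sigma> f \<in> ideal_generated (fg_ambient pol) K"
proof -
  obtain A c where A: "finite A" "A \<subseteq> K" "c ` A \<subseteq> fg_ambient pol" "f = (\<Sum>k\<in>A. c k * k)"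
    using assms(1) unfolding ideal_generated_def by blast
  \<comment> \<open>Coefficients are functions of the generator; that of a renamed generator is
    found by going back to the original one.\<close>
  define d where "d k = mps_rename \<sigma> (c (inv (mps_rename \<sigma>) k))" for k
  have "mps_rename \<sigma> f = (\<Sum>k\<in>A. d (mps_rename \<sigma> k) * mps_rename \<sigma> k)"
    by (simp add: A(4) additive.sum[OF additive_mps_rename] mps_rename_mult d_def
        inv_f_f[OF inj_mps_rename])
  also have "\<dots> = (\<Sum>k\<in>mps_rename \<sigma> ` A. d k * k)"
    by (simp add: sum.reindex inj_on_subset[OF inj_mps_rename subset_UNIV])
  finally have eq: "mps_rename \<sigma> f = (\<Sum>k\<in>mps_rename \<sigma> ` A. d k * k)" .
  have "d ` mps_rename \<sigma> ` A \<subseteq> fg_ambient pol"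
    using A(3) by (auto simp: d_def inv_f_f[OF inj_mps_rename] intro!: mps_rename_ambient)
  moreover have "mps_rename \<sigma> ` A \<subseteq> K"
    using A(2) assms(2) by blast
  ultimately show ?thesis
    unfolding ideal_generated_def using eq A(1) by blast
qed

text \<open>Since degrees are preserved, an approximation below degree \<open>n\<close> is renamed
  to one below degree \<open>n\<close>.\<close>

lemma mps_rename_adic_closure:
  assumes "f \<in> adic_closure (fg_ambient pol) K" "mps_rename \<sigma> ` K \<subseteq> K"
  shows "mps_rename \<sigma> f \<in> adic_closure (fg_ambient pol) K"
proof -
  have "\<exists>g\<in>K. \<forall>m. mdeg m < n \<longrightarrow> coeff (mps_rename \<sigma> f) m = coeff g m" for n
  proof -
    obtain g where "g \<in> K" "\<forall>m. mdeg m < n \<longrightarrow> coeff f m = coeff g m"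
      using assms(1) unfolding adic_closure_def by blast
    then show ?thesis
      using assms(2) by (intro bexI[of _ "mps_rename \<sigma> g"])
        (auto simp: coeff_mps_rename[OF \<sigma>] mdeg_map_key)
  qed
  then show ?thesis
    using assms(1) by (auto simp: adic_closure_def intro: mps_rename_ambient)
qed

end

text \<open>Additivity of \<open>w\<close> turns the relation for \<open>x\<close>, \<open>y\<close>
  into the one for \<open>w x\<close>, \<open>w y\<close>.\<close>

lemma mps_rename_fg_relations:
  assumes "bij w" "additive w"
  shows "mps_rename w ` fg_relations F \<subseteq> fg_relations F"
proof -
  have "mps_rename w (X (x + y) - fgl_subst F (X x) (X y)) =
      X (w x + w y) - fgl_subst F (X (w x)) (X (w y))" for x y
    using assms(1) by (simp add: mps_rename_X additive.diff[OF additive_mps_rename]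
        mps_rename_fgl_subst additive.add[OF assms(2)])
  moreover have "mps_rename w (X 0) = X 0"
    using assms by (simp add: mps_rename_X additive.zero)
  ultimately show ?thesis
    unfolding fg_relations_def by auto
qed

section \<open>The ambient ring as a subring\<close>

lemma mps_polynomials_add: "f \<in> mps_polynomials \<Longrightarrow> g \<in> mps_polynomials \<Longrightarrow> f + g \<in> mps_polynomials"
  unfolding mps_polynomials_def
  by (auto simp: plus_mps.rep_eq intro: finite_subset[of _ "{m. coeff f m \<noteq> 0} \<union> {m. coeff g m \<noteq> 0}"])

lemma mps_polynomials_uminus: "f \<in> mps_polynomials \<Longrightarrow> - f \<in> mps_polynomials"
  by (simp add: mps_polynomials_def uminus_mps.rep_eq)

lemma mps_polynomials_one: "1 \<in> mps_polynomials"
  unfolding mps_polynomials_def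
  by (auto simp: one_mps.rep_eq intro: finite_subset[of _ "{0}"])

lemma mps_polynomials_X: "X i \<in> mps_polynomials"
  unfolding mps_polynomials_def
  by (auto simp: X.rep_eq intro: finite_subset[of _ "{Poly_Mapping.single i 1}"])

lemma mps_polynomials_mult:
  assumes "f \<in> mps_polynomials" "g \<in> mps_polynomials"
  shows "f * g \<in> mps_polynomials"
proof -
  have "{m. coeff (f * g) m \<noteq> 0} \<subseteq> (\<lambda>(a, b). a + b) ` ({a. coeff f a \<noteq> 0} \<times> {b. coeff g b \<noteq> 0})"
  proof
    fix m assume "m \<in> {m. coeff (f * g) m \<noteq> 0}"
    then have "(\<Sum>(a, b)\<in>{(a, b). a + b = m}. coeff f a * coeff g b) \<noteq> 0"
      by (simp add: times_mps.rep_eq)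
    then obtain p where "p \<in> {(a, b). a + b = m}" "(case p of (a, b) \<Rightarrow> coeff f a * coeff g b) \<noteq> 0"
      by (elim sum.not_neutral_contains_not_neutral)
    then show "m \<in> (\<lambda>(a, b). a + b) ` ({a. coeff f a \<noteq> 0} \<times> {b. coeff g b \<noteq> 0})"
      by (intro image_eqI[of _ _ p]) auto
  qed
  then show ?thesis
    using assms by (auto simp: mps_polynomials_def intro: finite_subset)
qed

lemma fg_ambient_closed:
  "1 \<in> fg_ambient pol" "X i \<in> fg_ambient pol"
  "f \<in> fg_ambient pol \<Longrightarrow> g \<in> fg_ambient pol \<Longrightarrow> f + g \<in> fg_ambient pol"
  "f \<in> fg_ambient pol \<Longrightarrow> g \<in> fg_ambient pol \<Longrightarrow> f * g \<in> fg_ambient pol"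
  "f \<in> fg_ambient pol \<Longrightarrow> g \<in> fg_ambient pol \<Longrightarrow> f - g \<in> fg_ambient pol"
  using mps_polynomials_add[of f "- g"]
  by (auto simp: fg_ambient_def mps_polynomials_add mps_polynomials_mult mps_polynomials_one
      mps_polynomials_X mps_polynomials_uminus)

section \<open>The action on the formal group ring and on its localization\<close>

text \<open>Renaming preserves the kernel of \<pi> and so descends to the quotient; surjectivity
  makes the descended map unique, which justifies the description in \<open>act_S\<close>.\<close>

lemma act_S_proj:
  fixes \<pi> :: "('l::ab_group_add, 'r::comm_ring_1) mps \<Rightarrow> 's::comm_ring_1"
  assumes S: "formal_group_ring pol F \<pi>" and w: "bij w" "additive w"
    and f: "f \<in> fg_ambient pol"
  shows "act_S pol \<pi> w (\<pi> f) = \<pi> (mps_rename w f)"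
proof -
  have hom: "ring_hom_on (fg_ambient pol) \<pi>" and surj: "\<pi> ` fg_ambient pol = UNIV"
    and ker: "{f \<in> fg_ambient pol. \<pi> f = 0} =
      adic_closure (fg_ambient pol) (ideal_generated (fg_ambient pol) (fg_relations F))"
    using S by (auto simp: formal_group_ring_def)
  have diff: "\<pi> (g - h) = \<pi> g - \<pi> h" if "g \<in> fg_ambient pol" "h \<in> fg_ambient pol" for g h
  proof -
    have "\<pi> (h + (g - h)) = \<pi> h + \<pi> (g - h)"
      using hom that fg_ambient_closed(5) unfolding ring_hom_on_def by blast
    then show ?thesis by simp
  qed
  have wd: "\<pi> (mps_rename w g) = \<pi> (mps_rename w h)"
    if "g \<in> fg_ambient pol" "h \<in> fg_ambient pol" "\<pi> g = \<pi> h" for g h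
  proof -
    have "g - h \<in> {f \<in> fg_ambient pol. \<pi> f = 0}"
      using that by (simp add: diff fg_ambient_closed)
    then have "mps_rename w (g - h) \<in> {f \<in> fg_ambient pol. \<pi> f = 0}"
      unfolding ker using w
      by (intro mps_rename_adic_closure image_subsetI mps_rename_ideal_generated
          mps_rename_fg_relations)
    then show ?thesis
      using that w by (simp add: additive.diff[OF additive_mps_rename] diff mps_rename_ambient)
  qed
  \<comment> \<open>Any preimage of \<open>s\<close> may be chosen, by \<open>wd\<close>.\<close>
  define \<sigma> where "\<sigma> s = \<pi> (mps_rename w (SOME g. g \<in> fg_ambient pol \<and> \<pi> g = s))" for s
  have \<sigma>: "\<forall>f\<in>fg_ambient pol. \<sigma> (\<pi> f) = \<pi> (mps_rename w f)"
  proof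
    fix f :: "('l, 'r) mps" assume "f \<in> fg_ambient pol"
    with someI[of "\<lambda>g. g \<in> fg_ambient pol \<and> \<pi> g = \<pi> f" f] wd
    show "\<sigma> (\<pi> f) = \<pi> (mps_rename w f)"
      unfolding \<sigma>_def by blast
  qed
  have "act_S pol \<pi> w = \<sigma>"
    unfolding act_S_def
  proof (rule the_equality)
    fix \<tau> assume \<tau>: "\<forall>f\<in>fg_ambient pol. \<tau> (\<pi> f) = \<pi> (mps_rename w f)"
    show "\<tau> = \<sigma>"
    proof
      fix s
      obtain g where "g \<in> fg_ambient pol" "s = \<pi> g"
        using surj by blast
      then show "\<tau> s = \<sigma> s"
        using \<sigma> \<tau> by simp
    qed
  qed (rule \<sigma>)
  then show ?thesis
    using \<sigma> f by simp
qed

lemma ring_hom_act_S: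
  fixes \<pi> :: "('l::ab_group_add, 'r::comm_ring_1) mps \<Rightarrow> 's::comm_ring_1"
  assumes S: "formal_group_ring pol F \<pi>" and w: "bij w" "additive w"
  shows "ring_hom_on UNIV (act_S pol \<pi> w)"
proof -
  have hom: "ring_hom_on (fg_ambient pol) \<pi>" and surj: "\<pi> ` fg_ambient pol = UNIV"
    using S by (auto simp: formal_group_ring_def)
  note act = act_S_proj[OF S w]
  have "act_S pol \<pi> w 1 = 1"
    using act[of 1] hom by (simp add: fg_ambient_closed ring_hom_on_def mps_rename_one[OF w(1)])
  moreover have "act_S pol \<pi> w (s + t) = act_S pol \<pi> w s + act_S pol \<pi> w t \<and>
      act_S pol \<pi> w (s * t) = act_S pol \<pi> w s * act_S pol \<pi> w t" for s t
  proof -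
    obtain f g where fg: "f \<in> fg_ambient pol" "g \<in> fg_ambient pol" "s = \<pi> f" "t = \<pi> g"
      using surj by (metis UNIV_I imageE)
    then show ?thesis
      using act[of f] act[of g] act[of "f + g"] act[of "f * g"] hom
        mps_rename_ambient[OF w(1) fg(1)] mps_rename_ambient[OF w(1) fg(2)]
      by (simp add: fg_ambient_closed ring_hom_on_def mps_rename_add[OF w(1)]
          mps_rename_mult[OF w(1)])
  qed
  ultimately show ?thesis
    by (simp add: ring_hom_on_def)
qed

section \<open>Extension of ring homomorphisms to a localization\<close>

lemma ring_hom_on_UNIV_prod:
  assumes "ring_hom_on UNIV h"
  shows "h (\<Prod>i\<in>A. f i) = (\<Prod>i\<in>A. h (f i))" "h (x ^ n) = h x ^ n"
proof -
  have h: "h 1 = 1" "\<And>x y. h (x * y) = h x * h y"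
    using assms by (auto simp: ring_hom_on_def)
  show "h (\<Prod>i\<in>A. f i) = (\<Prod>i\<in>A. h (f i))"
    by (induction A rule: infinite_finite_induct) (simp_all add: h)
  show "h (x ^ n) = h x ^ n"
    by (induction n) (simp_all add: h)
qed

lemma unit_mult_cancel: "u dvd 1 \<Longrightarrow> x * u = y * u \<Longrightarrow> x = y" for u :: "'a::comm_ring_1"
proof -
  assume "u dvd 1" "x * u = y * u"
  then obtain v where "1 = u * v" "x * u * v = y * u * v"
    by (auto elim: dvdE)
  then show "x = y"
    by (simp add: mult.assoc)
qed

text \<open>The universal property of localization: a fraction \<open>s / d\<close> must go to
  \<open>h s / h d\<close>, so existence amounts to independence of the fraction and uniqueness to
  cancelling the unit \<open>h d\<close>.\<close>

lemma localization_lift: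
  fixes \<iota> :: "'s::comm_ring_1 \<Rightarrow> 'q::comm_ring_1" and h :: "'s \<Rightarrow> 't::comm_ring_1"
  assumes loc: "is_localization M \<iota>"
    and M: "1 \<in> M" "\<And>d e. d \<in> M \<Longrightarrow> e \<in> M \<Longrightarrow> d * e \<in> M"
    and h: "ring_hom_on UNIV h" "\<And>d. d \<in> M \<Longrightarrow> h d dvd 1"
  shows "\<exists>!\<tau>. ring_hom_on UNIV \<tau> \<and> (\<forall>s. \<tau> (\<iota> s) = h s)"
proof -
  have \<iota>_1: "\<iota> 1 = 1" and \<iota>_add: "\<And>x y. \<iota> (x + y) = \<iota> x + \<iota> y"
    and \<iota>_mult: "\<And>x y. \<iota> (x * y) = \<iota> x * \<iota> y"
    and unit: "\<And>d. d \<in> M \<Longrightarrow> \<iota> d dvd 1"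
    and frac: "\<And>q. \<exists>s. \<exists>d\<in>M. q * \<iota> d = \<iota> s"
    and ker: "\<And>s. \<iota> s = 0 \<Longrightarrow> \<exists>d\<in>M. d * s = 0"
    using loc by (auto simp: is_localization_def ring_hom_on_def)
  have h_1: "h 1 = 1" and h_add: "\<And>x y. h (x + y) = h x + h y"
    and h_mult: "\<And>x y. h (x * y) = h x * h y"
    using h(1) by (auto simp: ring_hom_on_def)
  interpret h: additive h
    by standard (rule h_add)
  interpret \<iota>: additive \<iota>
    by standard (rule \<iota>_add)
  obtain num den where nd: "\<And>q. q * \<iota> (den q) = \<iota> (num q)" "\<And>q. den q \<in> M"
    using frac by metis
  obtain iv where iv: "\<And>d. d \<in> M \<Longrightarrow> h d * iv d = 1"
    using h(2) unfolding dvd_def by metis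
  define \<tau> where "\<tau> q = h (num q) * iv (den q)" for q
  \<comment> \<open>Independence of the chosen fraction. Equality under \<iota> holds in the source
    only after multiplication by some \<open>e\<close> in \<open>M\<close>, whose image under
    \<open>h\<close> is a unit and cancels.\<close>
  have \<tau>: "\<tau> q * h d = h s" if d: "d \<in> M" and q: "q * \<iota> d = \<iota> s" for q d s
  proof -
    have "\<iota> (num q * d - s * den q) = 0"
      by (simp add: \<iota>.diff \<iota>_mult flip: nd(1) q)
    then obtain e where e: "e \<in> M" "e * (num q * d - s * den q) = 0"
      using ker by blast
    have "(h (num q) * h d) * h e = (h s * h (den q)) * h e"
      using arg_cong[OF e(2), of h] by (simp add: h_mult h.diff h.zero algebra_simps)
    then have "h (num q) * h d = h s * h (den q)"
      by (rule unit_mult_cancel[OF h(2)[OF e(1)]])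
    moreover have "\<tau> q * h d = h (num q) * h d * iv (den q)"
      by (simp add: \<tau>_def ac_simps)
    ultimately have "\<tau> q * h d = h s * (h (den q) * iv (den q))"
      by (simp add: mult.assoc)
    then show ?thesis
      by (simp add: iv nd(2))
  qed
  have \<tau>_\<iota>: "\<tau> (\<iota> s) = h s" for s
    using \<tau>[OF M(1), of "\<iota> s" s] by (simp add: \<iota>_1 h_1)
  have "ring_hom_on UNIV \<tau>"
    unfolding ring_hom_on_def
  proof (intro conjI ballI)
    show "\<tau> 1 = 1"
      using \<tau>_\<iota>[of 1] by (simp add: \<iota>_1 h_1)
    fix p q
    obtain s d t e where d: "d \<in> M" "p * \<iota> d = \<iota> s" and e: "e \<in> M" "q * \<iota> e = \<iota> t"
      using frac by metis
    note de = M(2)[OF d(1) e(1)]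
    have "(p + q) * \<iota> (d * e) = \<iota> (s * e + t * d)"
      by (simp add: \<iota>_mult \<iota>_add algebra_simps flip: d(2) e(2))
    from \<tau>[OF de this] have "\<tau> (p + q) * h (d * e) = (\<tau> p + \<tau> q) * h (d * e)"
      by (simp add: h_mult h_add algebra_simps flip: \<tau>[OF d] \<tau>[OF e])
    then show "\<tau> (p + q) = \<tau> p + \<tau> q"
      by (rule unit_mult_cancel[OF h(2)[OF de]])
    have "p * q * \<iota> (d * e) = \<iota> (s * t)"
      by (simp add: \<iota>_mult algebra_simps flip: d(2) e(2))
    from \<tau>[OF de this] have "\<tau> (p * q) * h (d * e) = \<tau> p * \<tau> q * h (d * e)"
      by (simp add: h_mult algebra_simps flip: \<tau>[OF d] \<tau>[OF e])
    then show "\<tau> (p * q) = \<tau> p * \<tau> q"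
      by (rule unit_mult_cancel[OF h(2)[OF de]])
  qed
  with \<tau>_\<iota> have "ring_hom_on UNIV \<tau> \<and> (\<forall>s. \<tau> (\<iota> s) = h s)"
    by blast
  moreover have "\<tau>' = \<tau>" if "ring_hom_on UNIV \<tau>'" "\<forall>s. \<tau>' (\<iota> s) = h s" for \<tau>'
  proof
    fix q
    obtain s d where d: "d \<in> M" "q * \<iota> d = \<iota> s"
      using frac by blast
    have "\<tau>' q * h d = \<tau> q * h d"
      using that arg_cong[OF d(2), of \<tau>'] by (simp add: ring_hom_on_def \<tau>[OF d])
    then show "\<tau>' q = \<tau> q"
      by (rule unit_mult_cancel[OF h(2)[OF d(1)]])
  qed
  ultimately show ?thesis
    by (intro ex1I[of _ \<tau>]) blast+
qed

lemma root_denominators_mult: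
  "d \<in> root_denominators D \<pi> \<Longrightarrow> e \<in> root_denominators D \<pi> \<Longrightarrow> d * e \<in> root_denominators D \<pi>"
proof -
  assume "d \<in> root_denominators D \<pi>" "e \<in> root_denominators D \<pi>"
  then obtain m n where "d = (\<Prod>\<alpha>\<in>roots D. \<pi> (X \<alpha>) ^ m \<alpha>)" "e = (\<Prod>\<alpha>\<in>roots D. \<pi> (X \<alpha>) ^ n \<alpha>)"
    by (auto simp: root_denominators_def)
  then have "d * e = (\<Prod>\<alpha>\<in>roots D. \<pi> (X \<alpha>) ^ (m \<alpha> + n \<alpha>))"
    by (simp add: power_add prod.distrib)
  then show ?thesis
    unfolding root_denominators_def by (intro CollectI exI[of _ "\<lambda>\<alpha>. m \<alpha> + n \<alpha>"]) simp
qed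

lemma one_in_root_denominators: "1 \<in> root_denominators D \<pi>"
  unfolding root_denominators_def by (auto intro!: exI[of _ "\<lambda>_. 0"])

text \<open>As \<open>w\<close> permutes the roots, it permutes the factors
  \<open>\<pi> (X \<alpha>)\<close>; the exponents become \<open>n \<circ> inv w\<close>.\<close>

lemma act_S_root_denominators:
  fixes \<pi> :: "('l::ab_group_add, 'r::comm_ring_1) mps \<Rightarrow> 's::comm_ring_1"
  assumes S: "formal_group_ring pol F \<pi>" and w: "bij w" "additive w" "w ` roots D = roots D"
    and d: "d \<in> root_denominators D \<pi>"
  shows "act_S pol \<pi> w d \<in> root_denominators D \<pi>"
proof -
  obtain n where n: "d = (\<Prod>\<alpha>\<in>roots D. \<pi> (X \<alpha>) ^ n \<alpha>)"
    using d by (auto simp: root_denominators_def)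
  have "act_S pol \<pi> w d = (\<Prod>\<alpha>\<in>roots D. \<pi> (X (w \<alpha>)) ^ n (inv w (w \<alpha>)))"
    unfolding n ring_hom_on_UNIV_prod[OF ring_hom_act_S[OF S w(1,2)]]
    by (simp add: act_S_proj[OF S w(1,2)] fg_ambient_closed mps_rename_X[OF w(1)]
        inv_f_f[OF bij_is_inj[OF w(1)]])
  also have "\<dots> = (\<Prod>\<beta>\<in>w ` roots D. \<pi> (X \<beta>) ^ n (inv w \<beta>))"
    by (simp add: prod.reindex inj_on_subset[OF bij_is_inj[OF w(1)] subset_UNIV])
  finally show ?thesis
    unfolding w(3) root_denominators_def by (intro CollectI exI[of _ "\<lambda>\<beta>. n (inv w \<beta>)"]) simp
qed

text \<open>Denominators are sent to denominators, hence to units under \<iota>, so the extension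
  described in \<open>act_Q\<close> exists and is unique.\<close>

lemma ring_hom_act_Q:
  fixes \<pi> :: "('l::ab_group_add, 'r::comm_ring_1) mps \<Rightarrow> 's::comm_ring_1"
    and \<iota> :: "'s \<Rightarrow> 'q::comm_ring_1"
  assumes S: "formal_group_ring pol F \<pi>"
    and loc: "is_localization (root_denominators D \<pi>) \<iota>"
    and w: "bij w" "additive w" "w ` roots D = roots D"
  shows "ring_hom_on UNIV (act_Q pol \<pi> \<iota> w)"
proof -
  have \<iota>: "ring_hom_on UNIV \<iota>" "\<And>d. d \<in> root_denominators D \<pi> \<Longrightarrow> \<iota> d dvd 1"
    using loc by (auto simp: is_localization_def)
  have "\<exists>!\<sigma>. ring_hom_on UNIV \<sigma> \<and> (\<forall>s. \<sigma> (\<iota> s) = \<iota> (act_S pol \<pi> w s))"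
  proof (rule localization_lift[OF loc one_in_root_denominators root_denominators_mult])
    show "ring_hom_on UNIV (\<lambda>s. \<iota> (act_S pol \<pi> w s))"
      using \<iota>(1) ring_hom_act_S[OF S w(1,2)] by (simp add: ring_hom_on_def)
  qed (use \<iota>(2) act_S_root_denominators[OF S w] in auto)
  from theI'[OF this] show ?thesis
    by (simp add: act_Q_def)
qed

section \<open>Coordinates of functionals\<close>

context based_datum
begin

lemma QWP_single: "w \<in> weyl D \<Longrightarrow> Poly_Mapping.single (par_coset D I w) q \<in> QWP D I"
  by (simp add: QWP_def par_quotient_def)

lemma dual_basis_in_QWP_dual: "dual_basis D I v \<in> QWP_dual D I"
proof -
  have "m + n \<in> QWP D I" if "m \<in> QWP D I" "n \<in> QWP D I" for m n :: "('l \<Rightarrow> 'l) set \<Rightarrow>\<^sub>0 'q::comm_ring_1"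
    using that Poly_Mapping.keys_add[of m n] by (auto simp: QWP_def)
  moreover have "Poly_Mapping.map ((*) q) m \<in> QWP D I" if "m \<in> QWP D I"
    for q and m :: "('l \<Rightarrow> 'l) set \<Rightarrow>\<^sub>0 'q::comm_ring_1"
    using that by (auto simp: QWP_def in_keys_iff map.rep_eq subset_iff)
  ultimately show ?thesis
    by (auto simp: QWP_dual_def dual_basis_def lookup_add map.rep_eq when_def)
qed

text \<open>Here uniqueness of minimal representatives enters: distinct ones lie in distinct cosets,
  so the functionals are dual to the basis of cosets.\<close>

lemma dual_basis_single:
  assumes "I \<subseteq> simple D" "v \<in> min_reps D I" "u \<in> min_reps D I"
  shows "dual_basis D I v (Poly_Mapping.single (par_coset D I u) 1) = (if u = v then 1 else 0)"
  using assms min_reps_coset_eq_iff[OF assms(1,3,2)]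
  by (auto simp: dual_basis_def QWP_single min_reps_def lookup_single when_def)

lemma sum_dual_basis_single:
  assumes "I \<subseteq> simple D" "u \<in> min_reps D I"
  shows "(\<Sum>v\<in>min_reps D I. b v * dual_basis D I v (Poly_Mapping.single (par_coset D I u) 1)) = b u"
proof -
  have "(\<Sum>v\<in>min_reps D I. b v * dual_basis D I v (Poly_Mapping.single (par_coset D I u) 1)) =
      (\<Sum>v\<in>min_reps D I. if u = v then b v else 0)"
    using assms by (intro sum.cong) (simp_all add: dual_basis_single)
  then show ?thesis
    using assms(2) by (simp add: finite_min_reps)
qed

text \<open>Evaluation at the basis element of a coset reads off a coordinate, so exhibiting one
  family of coordinates determines all of them.\<close>

lemma has_coordinates_iff:
  assumes "I \<subseteq> simple D" "has_coordinates D I \<xi> b"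
  shows "has_coordinates D I \<xi> a \<longleftrightarrow> (\<forall>w\<in>min_reps D I. a w = b w)"
proof
  assume "has_coordinates D I \<xi> a"
  then have "(\<lambda>m. \<Sum>v\<in>min_reps D I. a v * dual_basis D I v m) =
      (\<lambda>m. \<Sum>v\<in>min_reps D I. b v * dual_basis D I v m)"
    using assms(2) by (simp add: has_coordinates_def)
  note eq = fun_cong[OF this]
  show "\<forall>w\<in>min_reps D I. a w = b w"
  proof
    fix w assume w: "w \<in> min_reps D I"
    show "a w = b w"
      using eq[of "Poly_Mapping.single (par_coset D I w) 1"]
      by (simp only: sum_dual_basis_single[OF assms(1) w])
  qed
next
  assume "\<forall>w\<in>min_reps D I. a w = b w"
  with assms(2) show "has_coordinates D I \<xi> a"
    by (simp add: has_coordinates_def)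
qed

section \<open>The action of the twisted group algebra in coordinates\<close>

definition QW_elem :: "('l \<Rightarrow> 'l) set \<Rightarrow> (('l \<Rightarrow> 'l) \<Rightarrow> 'q::comm_ring_1) \<Rightarrow> ('l \<Rightarrow> 'l) \<Rightarrow>\<^sub>0 'q"
  where "QW_elem A b = (\<Sum>w\<in>A. Poly_Mapping.single w (b w))"

lemma lookup_QW_elem:
  "finite A \<Longrightarrow> Poly_Mapping.lookup (QW_elem A b) w = (if w \<in> A then b w else 0)"
  by (simp add: QW_elem_def lookup_sum lookup_single when_def)

lemma QW_elem_in_QW: "finite A \<Longrightarrow> A \<subseteq> weyl D \<Longrightarrow> QW_elem A b \<in> QW D"
  by (auto simp: QW_def in_keys_iff lookup_QW_elem split: if_splits)

lemma QW_act_QW_elem: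
  assumes "finite A" "I \<subseteq> simple D" "has_coordinates D I \<xi> c"
  shows "QW_act D act I (QW_elem A b) \<xi> =
    (\<lambda>m. \<Sum>w\<in>A. \<Sum>v\<in>min_reps D I. b w * act w (c v) * dual_basis D I (min_rep D I (w \<circ> v)) m)"
proof
  fix m
  have \<xi>: "\<xi> (Poly_Mapping.single (par_coset D I v) 1) = c v" if "v \<in> min_reps D I" for v
    using assms(2,3) that by (simp add: has_coordinates_def sum_dual_basis_single)
  have "QW_act D act I (QW_elem A b) \<xi> m = (\<Sum>w\<in>A. \<Sum>v\<in>min_reps D I.
      Poly_Mapping.lookup (QW_elem A b) w * act w (\<xi> (Poly_Mapping.single (par_coset D I v) 1)) *
        dual_basis D I (min_rep D I (w \<circ> v)) m)"
    \<comment> \<open>The action sums over the support, which is smaller than \<open>A\<close> where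
      \<open>b\<close> vanishes; the added terms are 0.\<close>
    unfolding QW_act_def using assms(1)
    by (intro sum.mono_neutral_left) (auto simp: in_keys_iff lookup_QW_elem split: if_splits)
  also have "\<dots> = (\<Sum>w\<in>A. \<Sum>v\<in>min_reps D I.
      b w * act w (c v) * dual_basis D I (min_rep D I (w \<circ> v)) m)"
    using assms(1) by (intro sum.cong) (simp_all add: lookup_QW_elem \<xi>)
  finally show "QW_act D act I (QW_elem A b) \<xi> m = \<dots>" .
qed

lemma QW_act_dual_basis_id:
  assumes I: "I \<subseteq> simple D"
    and act: "\<And>w. w \<in> weyl D \<Longrightarrow> act w 1 = 1" "\<And>w. w \<in> weyl D \<Longrightarrow> act w 0 = 0"
  shows "QW_act D act I (QW_elem (min_reps D I) b) (dual_basis D I id) =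
    (\<lambda>m. \<Sum>v\<in>min_reps D I. b v * dual_basis D I v m)"
proof -
  let ?e = "\<lambda>v :: 'l \<Rightarrow> 'l. if v = id then 1 else 0"
  have e: "has_coordinates D I (dual_basis D I id) ?e"
    unfolding has_coordinates_def
  proof
    fix m
    have "(\<Sum>v\<in>min_reps D I. ?e v * dual_basis D I v m) =
        (\<Sum>v\<in>min_reps D I. if v = id then dual_basis D I id m else 0)"
      by (intro sum.cong) auto
    then show "dual_basis D I id m = (\<Sum>v\<in>min_reps D I. ?e v * dual_basis D I v m)"
      by (simp add: finite_min_reps id_in_min_reps)
  qed
  show ?thesis
    unfolding QW_act_QW_elem[OF finite_min_reps I e]
  proof (intro ext sum.cong refl)
    fix m w assume w: "w \<in> min_reps D I"
    then have wW: "w \<in> weyl D"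
      by (simp add: min_reps_def)
    have "(\<Sum>v\<in>min_reps D I. b w * act w (?e v) * dual_basis D I (min_rep D I (w \<circ> v)) m) =
        (\<Sum>v\<in>min_reps D I. if v = id then b w * dual_basis D I (min_rep D I w) m else 0)"
      using wW by (intro sum.cong) (auto simp: act)
    also have "\<dots> = b w * dual_basis D I w m"
      using min_rep_eqI[OF I w par_coset_self] by (simp add: finite_min_reps id_in_min_reps)
    finally show "(\<Sum>v\<in>min_reps D I. b w * act w (?e v) *
        dual_basis D I (min_rep D I (w \<circ> v)) m) = b w * dual_basis D I w m" .
  qed
qed

text \<open>Linearity of \<psi> applies once \<xi> is written as an algebra element acting on
  \<open>dual_basis D I id\<close>; in the theorem \<xi> is the value of \<phi> at the
  generator.\<close>

lemma has_coordinates_comp: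
  assumes I: "I \<subseteq> simple D" and J: "J \<subseteq> simple D"
    and act: "\<And>w. w \<in> weyl D \<Longrightarrow> act w 1 = 1" "\<And>w. w \<in> weyl D \<Longrightarrow> act w 0 = 0"
    and \<psi>: "\<psi> \<in> QW_hom D act I J"
    and b: "has_coordinates D I \<xi> b"
    and c: "has_coordinates D J (\<psi> (dual_basis D I id)) c"
  shows "has_coordinates D J (\<psi> \<xi>)
    (\<lambda>w. \<Sum>(v, u)\<in>{(v, u). v \<in> min_reps D I \<and> u \<in> min_reps D J \<and> min_rep D J (v \<circ> u) = w}.
      b v * act v (c u))"
  unfolding has_coordinates_def
proof
  fix m
  let ?B = "QW_elem (min_reps D I) b" and ?P = "min_reps D I \<times> min_reps D J"
  let ?g = "\<lambda>(v, u). min_rep D J (v \<circ> u)"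
  have W: "v \<in> weyl D" if "v \<in> min_reps D K" for v K
    using that by (simp add: min_reps_def)
  have "\<xi> = QW_act D act I ?B (dual_basis D I id)"
    using b by (simp add: QW_act_dual_basis_id[OF I act] has_coordinates_def)
  moreover have "?B \<in> QW D"
    using W by (intro QW_elem_in_QW finite_min_reps) auto
  ultimately have "\<psi> \<xi> = QW_act D act J ?B (\<psi> (dual_basis D I id))"
    using \<psi> dual_basis_in_QWP_dual unfolding QW_hom_def by blast
  then have "\<psi> \<xi> m = (\<Sum>(v, u)\<in>?P. b v * act v (c u) * dual_basis D J (?g (v, u)) m)"
    by (simp add: QW_act_QW_elem[OF finite_min_reps J c] sum.cartesian_product)
  \<comment> \<open>Pairs are grouped by the representative of \<open>v \<circ> u\<close>; it always
    lies in \<open>min_reps D J\<close>, so no pair is lost.\<close>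
  also have "\<dots> = (\<Sum>w\<in>min_reps D J. \<Sum>p\<in>{p \<in> ?P. ?g p = w}.
      (case p of (v, u) \<Rightarrow> b v * act v (c u) * dual_basis D J (?g (v, u)) m))"
    by (rule sum.group[symmetric])
      (auto simp: finite_min_reps intro!: min_rep_in_min_reps[OF J] refl_group_comp dest: W)
  also have "\<dots> = (\<Sum>w\<in>min_reps D J. (\<Sum>(v, u)\<in>{(v, u). v \<in> min_reps D I \<and> u \<in> min_reps D J \<and>
      min_rep D J (v \<circ> u) = w}. b v * act v (c u)) * dual_basis D J w m)"
    by (intro sum.cong refl) (auto simp: sum_distrib_right intro!: sum.cong)
  finally show "\<psi> \<xi> m = \<dots>" .
qed

end

theorem proposition7p7:
  fixes D :: "'l::ab_group_add based_root_datum"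
    and \<Theta>\<^sub>P \<Theta>\<^sub>Q \<Theta>\<^sub>H :: "'l set"
    and F :: "nat \<Rightarrow> nat \<Rightarrow> 'r::comm_ring_1"
    and pol :: bool
    and \<pi> :: "('l, 'r) mps \<Rightarrow> 's::comm_ring_1"
    and \<iota> :: "'s \<Rightarrow> 'q::comm_ring_1"
    and \<phi> \<psi> :: "((('l \<Rightarrow> 'l) set \<Rightarrow>\<^sub>0 'q) \<Rightarrow> 'q) \<Rightarrow> (('l \<Rightarrow> 'l) set \<Rightarrow>\<^sub>0 'q) \<Rightarrow> 'q"
    and a b c :: "('l \<Rightarrow> 'l) \<Rightarrow> 'q"
  assumes "semisimple_root_datum D" and "is_base D"
    and "\<Theta>\<^sub>P \<subseteq> simple D" and "\<Theta>\<^sub>Q \<subseteq> simple D" and "\<Theta>\<^sub>H \<subseteq> simple D"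
    and "formal_group_law F" and "pol \<longrightarrow> polynomial_fgl F"
    and "formal_group_ring pol F \<pi>"
    and "root_regular D \<pi>"
    and "is_localization (root_denominators D \<pi>) \<iota>"
    and "\<phi> \<in> QW_hom D (act_Q pol \<pi> \<iota>) \<Theta>\<^sub>Q \<Theta>\<^sub>P"
    and "\<psi> \<in> QW_hom D (act_Q pol \<pi> \<iota>) \<Theta>\<^sub>P \<Theta>\<^sub>H"
    and "has_coordinates D \<Theta>\<^sub>P (\<phi> (dual_basis D \<Theta>\<^sub>Q id)) b"
    and "has_coordinates D \<Theta>\<^sub>H (\<psi> (dual_basis D \<Theta>\<^sub>P id)) c"
  shows "has_coordinates D \<Theta>\<^sub>H ((\<psi> \<circ> \<phi>) (dual_basis D \<Theta>\<^sub>Q id)) a \<longleftrightarrow>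
    (\<forall>w\<in>min_reps D \<Theta>\<^sub>H.
      a w = (\<Sum>(v, u)\<in>{(v, u). v \<in> min_reps D \<Theta>\<^sub>P \<and> u \<in> min_reps D \<Theta>\<^sub>H \<and>
                          min_rep D \<Theta>\<^sub>H (v \<circ> u) = w}.
        b v * act_Q pol \<pi> \<iota> v (c u)))"
proof -
  interpret based_datum D
    using assms by unfold_locales
  \<comment> \<open>Weyl group elements are bijective and additive and permute the roots, as the
    extension to the localization requires.\<close>
  have hom: "ring_hom_on UNIV (act_Q pol \<pi> \<iota> w)" if "w \<in> weyl D" for w
    using ring_hom_act_Q[OF assms(8,10)] that bij_weyl additive_weyl weyl_image_roots by blast
  have one: "act_Q pol \<pi> \<iota> w 1 = 1" if "w \<in> weyl D" for w
    using hom[OF that] by (simp add: ring_hom_on_def)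
  have zero: "act_Q pol \<pi> \<iota> w 0 = 0" if "w \<in> weyl D" for w
    using hom[OF that] by (intro additive.zero) (simp add: additive_def ring_hom_on_def)
  \<comment> \<open>Both directions follow from uniqueness of coordinates once the sums are known to
    be coordinates of the composite.\<close>
  show ?thesis
    unfolding comp_apply[of \<psi>]
    by (rule has_coordinates_iff[OF assms(5)
          has_coordinates_comp[OF assms(3,5) one zero assms(12-14)]])
qed

end
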